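(* Let $E_1,E_2\subset\mathbb R^p$, the numbers $\kappa_1,\kappa_2$, the orthonormal basis $(u_{1i}),(u_{2i}),(u_{3i}),(u_{4i}),(u_{5i})$, the angles $\alpha_i$, the vectors $v_i$, the vectors $y\ne y'$ in $\mathbb R^p$ and the vectors $\tilde y,\tilde y'$ be as described in the context. Case I ($\mathrm{span}E_1\cap\mathrm{span}E_2\ne\{0\}$). Define $$\Lambda_{g1}(y,y')=\|\tilde y\wedge\tilde y'\|^2-(1-\kappa_1-\kappa_2)\Big[\|y\wedge y'\|^2-\kappa_1\Big\|y\wedge y'\wedge\bigwedge_{i=1}^{k}u_{1i}\wedge\bigwedge_{i=1}^{k_3}u_{3i}\Big\|^2-\kappa_2\Big\|y\wedge y'\wedge\bigwedge_{i=1}^{k}v_i\wedge\bigwedge_{i=1}^{k_3}u_{3i}\wedge\bigwedge_{i=1}^{k_4}u_{4i}\Big\|^2\Big].$$ Then $\Lambda_{g1}(y,y')\ge0$. Case II ($\mathrm{span}E_1\cap\mathrm{span}E_2=\{0\}$). Define, with $\Pi=\prod_{i=1}^k\sin^2\alpha_i$, $$\Lambda_{g2}(y,y')=\|\tilde y\wedge\tilde y'\|^2-(1-\kappa_1-\kappa_2+\kappa_1\kappa_2\Pi)\Big[\|y\wedge y'\|^2-\kappa_1\Big\|y\wedge y'\wedge\bigwedge_{i=1}^{k}u_{1i}\Big\|^2-\kappa_2\Big\|y\wedge y'\wedge\bigwedge_{i=1}^{k}v_i\wedge\bigwedge_{i=1}^{k_4}u_{4i}\Big\|^2$$ $$+\kappa_1\kappa_2\Pi\Big\|y\wedge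 y'\wedge\bigwedge_{i=1}^{k}u_{1i}\wedge\bigwedge_{i=1}^{k}u_{2i}\wedge\bigwedge_{i=1}^{k_4}u_{4i}\Big\|^2\Big].$$ Then $\Lambda_{g2}(y,y')\ge0$.
   Context: Exterior powers of $\mathbb R^p$ carry the inner product $\langle x_1\wedge\dots\wedge x_r,\,y_1\wedge\dots\wedge y_r\rangle=\det(\langle x_s,y_t\rangle)$ and the associated norm. For a finite set $F$ of vectors, $\bigwedge_{x\in F}x$ is the exterior product in any order (defined up to sign). Setting. $E_1,E_2$ are finite subsets of $\mathbb R^p$, $|E_l|=k_l<p$, $k_1\le k_2$, with $\kappa_l=\|\bigwedge_{x\in E_l}x\|^2$ satisfying $0<\kappa_l<1$ ($l=1,2$), and $$0<1-\kappa_1-\kappa_2+\Big\|\bigwedge_{x\in E_1}x\wedge\bigwedge_{x\in E_2}x\Big\|^2<1.$$ There is an orthonormal basis $u_{11},\dots,u_{1k},u_{21},\dots,u_{2k},u_{31},\dots,u_{3k_3},u_{41},\dots,u_{4k_4},u_{51},\dots,u_{5k_5}$ of $\mathbb R^p$ (families may be empty), with $k+k_3=k_1$, $k+k_3+k_4=k_2$, $2k+k_3+k_4+k_5=p$, and (principal) angles $0<\alpha_i<\pi/2$, $i=1,\dots,k$, such that $u_{11},\dots,u_{1k},u_{31},\dots,u_{3k_3}$ is a basis of $\mathrm{span}E_1$ and, with $v_i=u_{1i}\cos\alpha_i+u_{2i}\sin\alpha_i$, the vectors $v_1,\dots,v_k,u_{31},\dots,u_{3k_3},u_{41},\dots,u_{4k_4}$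 form a basis of $\mathrm{span}E_2$. Case I is $\bigwedge_{E_1}x\wedge\bigwedge_{E_2}x=0$ (i.e. $k_3\ge1$); Case II is the case when this product is non-zero (i.e. $k_3=0$, the family $u_{3i}$ is absent). Write $\delta_{1,i}=1-\kappa_1\sin^2\alpha_i$, $\delta_{2,i}=1-\kappa_2\sin^2\alpha_i$ and define $0<\alpha_i'<\pi/2$ by $$\cos\alpha_i'=\frac{\cos\alpha_i}{\sqrt{\delta_{1,i}\delta_{2,i}}},\qquad \sin\alpha_i'=\frac{\sin\alpha_i\sqrt{1-\kappa_1-\kappa_2+\kappa_1\kappa_2\sin^2\alpha_i}}{\sqrt{\delta_{1,i}\delta_{2,i}}}.$$ Every $y\in\mathbb R^p$ is written uniquely as $y=y_0+\sum_{i=1}^{k_3}c_iu_{3i}+\sum_{i=1}^{k_4}d_iu_{4i}+\sum_{i=1}^{k_5}e_iu_{5i}$ with $y_0=\sum_{i=1}^k(a_i+b_i\cos\alpha_i)u_{1i}+\sum_{i=1}^kb_i\sin\alpha_i\,u_{2i}$ (the $c$-sum being absent in Case II). Put $$\tilde y_0=\sum_{i=1}^k\big(a_i\sqrt{\delta_{2,i}}+b_i\sqrt{\delta_{1,i}}\cos\alpha_i'\big)u_{1i}+\sum_{i=1}^kb_i\sqrt{\delta_{1,i}}\sin\alpha_i'\,u_{2i},$$ and $$\text{Case I: }\ \tilde y=\tilde y_0+\sum_ic_iu_{3i}+\sqrt{1-\kappa_1}\sum_id_iu_{4i}+\sqrt{1-\kappa_1-\kappa_2}\sum_ie_iu_{5i},$$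 $$\text{Case II: }\ \tilde y=\tilde y_0+\sqrt{1-\kappa_1}\sum_id_iu_{4i}+\sqrt{1-\kappa_1-\kappa_2+\kappa_1\kappa_2\textstyle\prod_{i=1}^k\sin^2\alpha_i}\ \sum_ie_iu_{5i}.$$ The vector $\tilde y'$ is obtained from $y'$ by the same formulas (with primed coefficients $a_i',b_i',c_i',d_i',e_i'$). *)

theory Defs
  imports "HOL-Analysis.Analysis" "Jordan_Normal_Form.Determinant"
begin

text \<open>A list \<open>xs = [x\<^sub>1, \<dots>, x\<^sub>r]\<close> stands for the decomposable \<open>r\<close>-vector
  \<open>x\<^sub>1 \<and> \<dots> \<and> x\<^sub>r\<close>, so the exterior product of two decomposable multivectors is
  list concatenation. Exterior powers of different degree are orthogonal.\<close>

definition wedge_inner :: "'a::real_inner list \<Rightarrow> 'a list \<Rightarrow> real" where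
  "wedge_inner xs ys =
     (if length xs = length ys
      then Determinant.det (Matrix.mat (length xs) (length xs) (\<lambda>(s, t). inner (xs ! s) (ys ! t)))
      else 0)"

definition wedge_norm :: "'a::real_inner list \<Rightarrow> real" where
  "wedge_norm xs = sqrt (wedge_inner xs xs)"

lemma wedge_inner_self_nonneg: "0 \<le> wedge_inner xs (xs :: 'a::euclidean_space list)"
proof -
  define n where "n = length xs"
  define P where "P = {p. p permutes {0..<n}}"
  define G where "G r = (\<Prod>i = 0..<n. inner (xs ! i) (xs ! r i))" for r :: "nat \<Rightarrow> nat"
  define D where "D b = (\<Sum>p\<in>P. signof p * (\<Prod>i = 0..<n. inner (xs ! p i) (b i)))"
    for b :: "nat \<Rightarrow> 'a"
  have finP: "finite P" unfolding P_def by (simp add: finite_permutations)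
  have W: "wedge_inner xs xs = (\<Sum>r\<in>P. signof r * G r)"
    unfolding wedge_inner_def Determinant.det_def P_def G_def n_def
    by (auto intro!: sum.cong prod.cong simp: permutes_in_image dest: permutes_in_image)
  have E: "(\<Sum>b\<in>PiE {0..<n} (\<lambda>_. Basis).
              (\<Prod>i = 0..<n. inner (xs ! p i) (b i)) * (\<Prod>i = 0..<n. inner (xs ! q i) (b i)))
           = (\<Prod>i = 0..<n. inner (xs ! p i) (xs ! q i))" for p q
  proof -
    have "(\<Prod>i = 0..<n. inner (xs ! p i) (xs ! q i))
        = (\<Prod>i = 0..<n. \<Sum>b\<in>Basis. inner (xs ! p i) b * inner (xs ! q i) b)"
      by (intro prod.cong refl) (rule euclidean_inner)
    also have "\<dots> = (\<Sum>b\<in>PiE {0..<n} (\<lambda>_. Basis).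
        (\<Prod>i = 0..<n. inner (xs ! p i) (b i) * inner (xs ! q i) (b i)))"
      by (rule prod_sum_PiE) auto
    finally show ?thesis by (simp add: prod.distrib)
  qed
  have R: "(\<Sum>q\<in>P. signof p * signof q * (\<Prod>i = 0..<n. inner (xs ! p i) (xs ! q i)))
           = (\<Sum>r\<in>P. signof r * G r)" if p: "p \<in> P" for p
  proof -
    have pp: "p permutes {0..<n}" using p by (simp add: P_def)
    have bij: "bij_betw (\<lambda>r. r \<circ> p) P P"
      unfolding P_def by (rule bij_betw_byWitness[where f' = "\<lambda>r. r \<circ> Hilbert_Choice.inv p"])
        (auto simp: permutes_compose[OF pp] permutes_compose[OF permutes_inv[OF pp]]
          comp_assoc permutes_inv_o[OF pp])
    have "(\<Sum>q\<in>P. signof p * signof q * (\<Prod>i = 0..<n. inner (xs ! p i) (xs ! q i)))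
        = (\<Sum>r\<in>P. signof p * signof (r \<circ> p) * (\<Prod>i = 0..<n. inner (xs ! p i) (xs ! (r \<circ> p) i)))"
      by (rule sum.reindex_bij_betw[OF bij, symmetric])
    also have "\<dots> = (\<Sum>r\<in>P. signof r * G r)"
    proof (rule sum.cong)
      fix r assume "r \<in> P"
      then have rp: "r permutes {0..<n}" by (simp add: P_def)
      have "G r = (\<Prod>i = 0..<n. inner (xs ! p i) (xs ! (r \<circ> p) i))"
        unfolding G_def using prod.permute[OF pp, of "\<lambda>i. inner (xs ! i) (xs ! r i)"]
        by (simp add: o_def)
      moreover have "sign (r \<circ> p) = sign r * sign p"
        using rp pp by (intro sign_compose) (auto simp: permutation_permutes)
      then have "(signof p :: real) * signof (r \<circ> p) = signof r"
        by (auto simp: sign_def split: if_splits)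
      ultimately show "signof p * signof (r \<circ> p) * (\<Prod>i = 0..<n. inner (xs ! p i) (xs ! (r \<circ> p) i))
          = signof r * G r" by simp
    qed simp
    finally show ?thesis .
  qed
  have "(\<Sum>b\<in>PiE {0..<n} (\<lambda>_. Basis). (D b)\<^sup>2)
      = (\<Sum>p\<in>P. \<Sum>q\<in>P. signof p * signof q * (\<Sum>b\<in>PiE {0..<n} (\<lambda>_. Basis).
            (\<Prod>i = 0..<n. inner (xs ! p i) (b i)) * (\<Prod>i = 0..<n. inner (xs ! q i) (b i))))"
  proof -
    let ?B = "PiE {0..<n} (\<lambda>_. Basis :: 'a set)"
    let ?X = "\<lambda>p b. \<Prod>i = 0..<n. inner (xs ! p i) (b i)"
    have "(\<Sum>b\<in>?B. (D b)\<^sup>2)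
        = (\<Sum>b\<in>?B. \<Sum>p\<in>P. \<Sum>q\<in>P. signof p * signof q * (?X p b * ?X q b))"
      unfolding D_def power2_eq_square sum_product by (simp add: mult_ac)
    also have "\<dots> = (\<Sum>p\<in>P. \<Sum>b\<in>?B. \<Sum>q\<in>P. signof p * signof q * (?X p b * ?X q b))"
      by (rule sum.swap)
    also have "\<dots> = (\<Sum>p\<in>P. \<Sum>q\<in>P. \<Sum>b\<in>?B. signof p * signof q * (?X p b * ?X q b))"
      by (intro sum.cong refl sum.swap)
    finally show ?thesis by (simp only: sum_distrib_left)
  qed
  also have "\<dots> = of_nat (card P) * wedge_inner xs xs"
    unfolding E W by (simp add: R)
  finally have "0 \<le> of_nat (card P) * wedge_inner xs xs"
    by (metis (no_types, lifting) sum_nonneg zero_le_power2)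
  moreover have "card P > 0" using finP permutes_id[of "{0..<n}"] by (auto simp: P_def card_gt_0_iff simp del: permutes_id)
  ultimately show ?thesis by (simp add: zero_le_mult_iff)
qed

lemma wedge_norm_power2: "(wedge_norm xs)\<^sup>2 = wedge_inner xs (xs :: 'a::euclidean_space list)"
  by (simp add: wedge_norm_def wedge_inner_self_nonneg)

definition is_basis_of :: "'a::real_vector list \<Rightarrow> 'a set \<Rightarrow> bool" where
  "is_basis_of xs V \<longleftrightarrow> distinct xs \<and> independent (set xs) \<and> span (set xs) = V"

definition orthonormal_list :: "'a::real_inner list \<Rightarrow> bool" where
  "orthonormal_list xs \<longleftrightarrow>
     (\<forall>i < length xs. \<forall>j < length xs. inner (xs ! i) (xs ! j) = (if i = j then 1 else 0))"

text \<open>Finite families \<open>u\<^sub>1, \<dots>, u\<^sub>m\<close> are given by \<open>u :: nat \<Rightarrow> 'a\<close>, indexed by \<open>0, \<dots>, m - 1\<close>.\<close>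

abbreviation fam :: "(nat \<Rightarrow> 'a) \<Rightarrow> nat \<Rightarrow> 'a list" where
  "fam u m \<equiv> map u [0..<m]"

definition delta :: "real \<Rightarrow> real \<Rightarrow> real" where
  "delta \<kappa> \<alpha> = 1 - \<kappa> * (sin \<alpha>)\<^sup>2"

definition lin_comb :: "nat \<Rightarrow> (nat \<Rightarrow> real) \<Rightarrow> (nat \<Rightarrow> 'a::real_vector) \<Rightarrow> 'a" where
  "lin_comb m c u = (\<Sum>i<m. c i *\<^sub>R u i)"

definition y_zero ::
  "nat \<Rightarrow> (nat \<Rightarrow> real) \<Rightarrow> (nat \<Rightarrow> 'a) \<Rightarrow> (nat \<Rightarrow> 'a) \<Rightarrow> (nat \<Rightarrow> real) \<Rightarrow> (nat \<Rightarrow> real)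
     \<Rightarrow> 'a::real_vector" where
  "y_zero k \<alpha> u1 u2 a b =
     lin_comb k (\<lambda>i. a i + b i * cos (\<alpha> i)) u1 + lin_comb k (\<lambda>i. b i * sin (\<alpha> i)) u2"

definition y_zero_tilde ::
  "real \<Rightarrow> real \<Rightarrow> nat \<Rightarrow> (nat \<Rightarrow> real) \<Rightarrow> (nat \<Rightarrow> real) \<Rightarrow> (nat \<Rightarrow> 'a) \<Rightarrow> (nat \<Rightarrow> 'a)
     \<Rightarrow> (nat \<Rightarrow> real) \<Rightarrow> (nat \<Rightarrow> real) \<Rightarrow> 'a::real_vector" where
  "y_zero_tilde \<kappa>1 \<kappa>2 k \<alpha> \<alpha>' u1 u2 a b =
     lin_comb k (\<lambda>i. a i * sqrt (delta \<kappa>2 (\<alpha> i)) + b i * sqrt (delta \<kappa>1 (\<alpha> i)) * cos (\<alpha>' i)) u1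
     + lin_comb k (\<lambda>i. b i * sqrt (delta \<kappa>1 (\<alpha> i)) * sin (\<alpha>' i)) u2"

end

theory Submission
  imports Defs
begin

text \<open>For an orthonormal list \<open>bs\<close>, the squared norm of \<open>y \<and> y'\<close> wedged with \<open>bs\<close> is the Gram
  determinant of the projections of \<open>y\<close>, \<open>y'\<close> onto the orthogonal complement of \<open>bs\<close>. Let \<open>I\<close> be the
  inner product and let \<open>A\<close>, \<open>B\<close>, \<open>R\<close> be the inner products of the projections onto the spans of
  \<open>E1\<close>, \<open>E2\<close> and (in Case II) \<open>E1 \<union> E2\<close>. Put \<open>\<tau> = 0\<close> in Case I, \<open>\<tau> = \<kappa>1 \<kappa>2 \<Prod> sin\<^sup>2 \<alpha>\<^sub>i\<close> in Case II
  and \<open>C = 1 - \<kappa>1 - \<kappa>2 + \<tau>\<close>; a change of basis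
  shows that \<open>\<tau>\<close> is the squared norm of the product of \<open>E1\<close> and \<open>E2\<close>, so \<open>C > 0\<close> by hypothesis. The Gram form of the modified vectors is
  \<open>C I + X\<close> with \<open>X = \<kappa>1 A + \<kappa>2 B - \<tau> R\<close>, and, \<open>D\<close> denoting the determinant of a form on the pair
  \<open>(y, y')\<close>, expansion yields
  \<open>\<Lambda> = D X + C (\<kappa>1 D A + \<kappa>2 D B - \<tau> D R)\<close>. In Case I this is visibly non-negative.

  In Case II the polarised expression is a bilinear form on the sum of the planes spanned by
  \<open>u1 i\<close>, \<open>u2 i\<close> and the lines spanned by \<open>u4 l\<close>. Pairs involving a line contribute non-negatively.
  A plane paired with itself contributes a multiple of the squared area \<open>f\<^sub>i\<^sup>2\<close> spanned by the components of
  \<open>y\<close>, \<open>y'\<close> in it, and two different planes contribute at least a multiple of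
  \<open>cos \<alpha>\<^sub>i cos \<alpha>\<^sub>j f\<^sub>i f\<^sub>j\<close>, which may be negative. The resulting quadratic form in the \<open>f\<^sub>i\<close> is positive
  semidefinite.\<close>

subsection \<open>Gram determinants\<close>

text \<open>Gram matrices transform by congruence, so a linear substitution multiplies the squared
  norm by the square of its determinant.\<close>

lemma wedge_inner_linear_image:
  fixes xs ys :: "'a::real_inner list"
  assumes A: "A \<in> carrier_mat n n" and xs: "length xs = n" and ys: "length ys = n"
    and eq: "\<And>i. i < n \<Longrightarrow> ys ! i = (\<Sum>j<n. A $$ (i, j) *\<^sub>R xs ! j)"
  shows "wedge_inner ys ys = (Determinant.det A)\<^sup>2 * wedge_inner xs xs"
proof -
  define G where "G = Matrix.mat n n (\<lambda>(s, t). inner (xs ! s) (xs ! t))"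
  have G: "G \<in> carrier_mat n n" by (simp add: G_def)
  have "Matrix.mat n n (\<lambda>(s, t). inner (ys ! s) (ys ! t)) = A * G * transpose_mat A"
  proof (rule eq_matI)
    fix s t assume "s < dim_row (A * G * transpose_mat A)" "t < dim_col (A * G * transpose_mat A)"
    then have st: "s < n" "t < n" using A by auto
    have "inner (ys ! s) (ys ! t)
        = (\<Sum>j<n. \<Sum>i<n. A $$ (s, i) * inner (xs ! i) (xs ! j) * A $$ (t, j))"
      by (simp add: eq st inner_sum_left inner_sum_right sum_distrib_left mult_ac)
    also have "\<dots> = (A * G * transpose_mat A) $$ (s, t)"
      using st A G by (simp add: scalar_prod_def G_def sum_distrib_right atLeast0LessThan)
    finally show "Matrix.mat n n (\<lambda>(s, t). inner (ys ! s) (ys ! t)) $$ (s, t)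
        = (A * G * transpose_mat A) $$ (s, t)" using st by simp
  qed (use A in auto)
  moreover have "Determinant.det (A * G * transpose_mat A) = (Determinant.det A)\<^sup>2 * Determinant.det G"
    using A G by (simp add: det_mult[of _ n] det_transpose power2_eq_square)
  ultimately show ?thesis
    by (simp add: wedge_inner_def xs ys G_def)
qed

lemma orthonormal_list_append:
  "orthonormal_list (xs @ ys) \<longleftrightarrow>
     orthonormal_list xs \<and> orthonormal_list ys \<and> (\<forall>x\<in>set xs. \<forall>y\<in>set ys. inner x y = 0)"
  (is "?L \<longleftrightarrow> ?R")
proof
  assume L: ?L
  have *: "inner ((xs @ ys) ! i) ((xs @ ys) ! j) = (if i = j then 1 else 0)"
    if "i < length xs + length ys" "j < length xs + length ys" for i j
    using L that by (auto simp: orthonormal_list_def)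
  have "inner (xs ! i) (xs ! j) = (if i = j then 1 else 0)"
    if "i < length xs" "j < length xs" for i j using *[of i j] that by (simp add: nth_append)
  moreover have "inner (ys ! i) (ys ! j) = (if i = j then 1 else 0)"
    if "i < length ys" "j < length ys" for i j
    using *[of "length xs + i" "length xs + j"] that by (simp add: nth_append)
  moreover have "inner (xs ! i) (ys ! j) = 0" if "i < length xs" "j < length ys" for i j
    using *[of i "length xs + j"] that by (simp add: nth_append)
  ultimately show ?R by (auto simp: orthonormal_list_def in_set_conv_nth)
next
  assume ?R
  then show ?L
    by (auto simp: orthonormal_list_def nth_append inner_commute)
qed

lemma orthonormal_fam:
  "orthonormal_list (fam u m) \<longleftrightarrow>
     (\<forall>i<m. \<forall>j<m. inner (u i) (u j) = (if i = j then 1 else 0))"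
  by (simp add: orthonormal_list_def)

lemma orthonormal_list_expansion:
  fixes xs :: "'a::real_inner list"
  assumes on: "orthonormal_list xs" and x: "x \<in> span (set xs)"
  shows "x = (\<Sum>j<length xs. inner x (xs ! j) *\<^sub>R xs ! j)"
  using x
proof (induction rule: span_induct_alt)
  case base
  then show ?case by simp
next
  case (step c z w)
  then obtain i where i: "i < length xs" "z = xs ! i" by (auto simp: in_set_conv_nth)
  have "(\<Sum>j<length xs. inner z (xs ! j) *\<^sub>R xs ! j)
      = (\<Sum>j<length xs. if j = i then xs ! j else 0)"
    using on i by (intro sum.cong) (auto simp: orthonormal_list_def)
  also have "\<dots> = z" using i by simp
  finally have z: "(\<Sum>j<length xs. inner z (xs ! j) *\<^sub>R xs ! j) = z" .
  have "(\<Sum>j<length xs. inner (c *\<^sub>R z + w) (xs ! j) *\<^sub>R xs ! j)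
     = c *\<^sub>R (\<Sum>j<length xs. inner z (xs ! j) *\<^sub>R xs ! j) + (\<Sum>j<length xs. inner w (xs ! j) *\<^sub>R xs ! j)"
    by (simp add: inner_add_left scaleR_add_left sum.distrib scaleR_sum_right)
  then show ?case using z step by simp
qed

lemma wedge_inner_orthonormal: "orthonormal_list xs \<Longrightarrow> wedge_inner xs xs = 1"
proof -
  assume on: "orthonormal_list xs"
  have "Matrix.mat (length xs) (length xs) (\<lambda>(s, t). inner (xs ! s) (xs ! t)) = 1\<^sub>m (length xs)"
    using on by (intro eq_matI) (auto simp: orthonormal_list_def)
  then show ?thesis by (simp add: wedge_inner_def)
qed

lemma sum_lessThan_add: "(\<Sum>j<m + n. f j) = (\<Sum>j<m. f j) + (\<Sum>j<n. f (m + j :: nat))"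
  by (induction n) (simp_all add: add.assoc)

text \<open>Both families are expanded in the given orthonormal bases; the change of basis matrix of
  the concatenation is block diagonal.\<close>

lemma wedge_inner_append_span:
  fixes xs ys us vs :: "'a::real_inner list"
  assumes us: "orthonormal_list us" "length xs = length us" "set xs \<subseteq> span (set us)"
    and vs: "orthonormal_list vs" "length ys = length vs" "set ys \<subseteq> span (set vs)"
  shows "wedge_inner (xs @ ys) (xs @ ys)
    = wedge_inner xs xs * wedge_inner ys ys * wedge_inner (us @ vs) (us @ vs)"
proof -
  define m n where "m = length us" and "n = length vs"
  define M where "M = Matrix.mat m m (\<lambda>(i, j). inner (xs ! i) (us ! j))"
  define N where "N = Matrix.mat n n (\<lambda>(i, j). inner (ys ! i) (vs ! j))"
  have M: "M \<in> carrier_mat m m" and N: "N \<in> carrier_mat n n" by (auto simp: M_def N_def)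
  have len: "length xs = m" "length us = m" "length ys = n" "length vs = n"
    using us vs by (auto simp: m_def n_def)
  have ex: "xs ! i = (\<Sum>j<m. M $$ (i, j) *\<^sub>R us ! j)" if "i < m" for i
  proof -
    have "xs ! i \<in> span (set us)" using that us len by (metis nth_mem subset_eq)
    from orthonormal_list_expansion[OF us(1) this] show ?thesis
      unfolding len using that by (simp add: M_def)
  qed
  have ey: "ys ! i = (\<Sum>j<n. N $$ (i, j) *\<^sub>R vs ! j)" if "i < n" for i
  proof -
    have "ys ! i \<in> span (set vs)" using that vs len by (metis nth_mem subset_eq)
    from orthonormal_list_expansion[OF vs(1) this] show ?thesis
      unfolding len using that by (simp add: N_def)
  qed
  have wx: "wedge_inner xs xs = (Determinant.det M)\<^sup>2"
    using wedge_inner_linear_image[OF M, of us xs] ex len wedge_inner_orthonormal[OF us(1)] by simp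
  have wy: "wedge_inner ys ys = (Determinant.det N)\<^sup>2"
    using wedge_inner_linear_image[OF N, of vs ys] ey len wedge_inner_orthonormal[OF vs(1)] by simp
  define A where "A = four_block_mat M (0\<^sub>m m n) (0\<^sub>m n m) N"
  have A: "A \<in> carrier_mat (m + n) (m + n)" using M N by (simp add: A_def)
  have detA: "Determinant.det A = Determinant.det M * Determinant.det N"
    unfolding A_def using M N by (intro det_four_block_mat_upper_right_zero) auto
  have "(xs @ ys) ! i = (\<Sum>j<m + n. A $$ (i, j) *\<^sub>R (us @ vs) ! j)" if i: "i < m + n" for i
  proof -
    have "(\<Sum>j<m + n. A $$ (i, j) *\<^sub>R (us @ vs) ! j)
      = (\<Sum>j<m. A $$ (i, j) *\<^sub>R us ! j) + (\<Sum>j<n. A $$ (i, m + j) *\<^sub>R vs ! j)"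
      using len by (simp add: sum_lessThan_add nth_append)
    also have "\<dots> = (xs @ ys) ! i"
      using ex ey len i M N by (auto simp: A_def nth_append)
    finally show ?thesis by simp
  qed
  then have "wedge_inner (xs @ ys) (xs @ ys)
      = (Determinant.det A)\<^sup>2 * wedge_inner (us @ vs) (us @ vs)"
    by (intro wedge_inner_linear_image[OF A]) (auto simp: len)
  then show ?thesis by (simp add: detA wx wy power_mult_distrib)
qed

subsection \<open>Determinants of binary quadratic forms\<close>

text \<open>A triple \<open>(m y y, m y y', m y' y')\<close> records a symmetric bilinear form \<open>m\<close> on a fixed pair of vectors;
  \<open>polar\<close> is the polarisation of twice its determinant.\<close>

type_synonym form = "real \<times> real \<times> real"

definition polar :: "form \<Rightarrow> form \<Rightarrow> real" where
  "polar m n = fst m * snd (snd n) + snd (snd m) * fst n - 2 * fst (snd m) * fst (snd n)"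

text \<open>The rank-one form of a linear functional with values \<open>s\<close> and
  \<open>t\<close> on the two vectors. The Gram form of an orthogonal projection is a sum of these,
  one for each vector of an orthonormal basis.\<close>

definition sqform :: "real \<Rightarrow> real \<Rightarrow> form" where
  "sqform s t = (s * s, s * t, t * t)"

lemma bilinear_polar: "bilinear polar"
  unfolding bilinear_def linear_iff by (simp add: polar_def algebra_simps)

lemma polar_commute: "polar m n = polar n m"
  by (simp add: polar_def)

text \<open>All positivity below stems from this: bilinearity reduces every polarised determinant to
  squared minors of coordinates.\<close>

lemma polar_sqform: "polar (sqform s s') (sqform t t') = (s * t' - s' * t)\<^sup>2"
  by (simp add: polar_def sqform_def power2_eq_square algebra_simps)

lemmas polar_simps = bilinear_ladd[OF bilinear_polar] bilinear_radd[OF bilinear_polar]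
  bilinear_lsub[OF bilinear_polar] bilinear_rsub[OF bilinear_polar]
  bilinear_lmul[OF bilinear_polar] bilinear_rmul[OF bilinear_polar]
  bilinear_lzero[OF bilinear_polar] bilinear_rzero[OF bilinear_polar]

text \<open>\<open>C\<close> is chosen so that the terms in \<open>polar I I\<close> cancel. The
  mixed terms cancel as well, since those in the bracket combine to a multiple of
  \<open>polar I X\<close>.\<close>

lemma polar_expansion:
  fixes I A B R :: form and p q \<tau> :: real
  defines "C \<equiv> 1 - p - q + \<tau>"
  defines "X \<equiv> p *\<^sub>R A + q *\<^sub>R B - \<tau> *\<^sub>R R"
  shows "polar (C *\<^sub>R I + X) (C *\<^sub>R I + X)
      - C * (polar I I - p * polar (I - A) (I - A) - q * polar (I - B) (I - B)
        + \<tau> * polar (I - R) (I - R))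
    = polar X X + C * (p * polar A A + q * polar B B - \<tau> * polar R R)"
  unfolding C_def X_def
  by (simp add: polar_simps polar_commute[of A I] polar_commute[of B I] polar_commute[of R I]
    polar_commute[of B A] polar_commute[of R A] polar_commute[of R B] algebra_simps)

text \<open>The right-hand side of \<open>polar_expansion\<close>, polarised in \<open>(A, B, R)\<close>.\<close>

definition Phi :: "real \<Rightarrow> real \<Rightarrow> real \<Rightarrow> form \<times> form \<times> form \<Rightarrow> form \<times> form \<times> form \<Rightarrow> real" where
  "Phi p q \<tau> = (\<lambda>(A, B, R) (A', B', R').
     polar (p *\<^sub>R A + q *\<^sub>R B - \<tau> *\<^sub>R R) (p *\<^sub>R A' + q *\<^sub>R B' - \<tau> *\<^sub>R R')
     + (1 - p - q + \<tau>) * (p * polar A A' + q * polar B B' - \<tau> * polar R R'))"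

lemma bilinear_Phi: "bilinear (Phi p q \<tau>)"
  unfolding bilinear_def linear_iff
  by (simp add: Phi_def case_prod_unfold polar_simps algebra_simps)

lemma Phi_commute: "Phi p q \<tau> v w = Phi p q \<tau> w v"
  by (simp add: Phi_def polar_commute split: prod.splits)

text \<open>\<open>(g, h)\<close> are the coordinates with respect to \<open>u1 i\<close>, \<open>u2 i\<close>, so that \<open>c * g + s * h\<close> is the
  inner product with \<open>v i\<close>.\<close>

definition plane_block :: "real \<Rightarrow> real \<Rightarrow> real \<Rightarrow> real \<Rightarrow> real \<Rightarrow> real \<Rightarrow> form \<times> form \<times> form" where
  "plane_block c s g g' h h' =
     (sqform g g', sqform (c * g + s * h) (c * g' + s * h'), sqform g g' + sqform h h')"

text \<open>A direction \<open>u4 l\<close> is orthogonal to the span of \<open>E1\<close> and lies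
  in the span of \<open>E2\<close>; this dictates the entries for the projections \<open>A\<close>,
  \<open>B\<close>, \<open>R\<close>.\<close>

definition line_block :: "real \<Rightarrow> real \<Rightarrow> form \<times> form \<times> form" where
  "line_block d d' = (0, sqform d d', sqform d d')"

section \<open>Estimates on pairs of blocks\<close>

lemma Phi_line_line:
  assumes "0 \<le> \<tau>" "\<tau> \<le> q" "0 \<le> 1 - p - q + \<tau>"
  shows "0 \<le> Phi p q \<tau> (line_block d d') (line_block e e')"
proof -
  have "Phi p q \<tau> (line_block d d') (line_block e e')
     = ((q - \<tau>)\<^sup>2 + (1 - p - q + \<tau>) * (q - \<tau>)) * (d * e' - d' * e)\<^sup>2"
    by (simp add: Phi_def line_block_def polar_simps polar_sqform) (simp add: power2_eq_square algebra_simps)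
  then show ?thesis using assms by simp
qed

text \<open>Within one plane every 2 by 2 minor is a multiple of the single area
  \<open>g * h' - g' * h\<close>. In the application \<open>\<pi>\<close> is the product of the
  squared sines of the other planes.\<close>

lemma Phi_plane_self:
  assumes "c\<^sup>2 + s\<^sup>2 = 1" "\<tau> = p * q * s\<^sup>2 * \<pi>"
  shows "Phi p q \<tau> (plane_block c s g g' h h') (plane_block c s g g' h h')
    = 2 * p * q * (1 - \<pi>) * (s * (g * h' - g' * h))\<^sup>2"
proof -
  define w where "w = g * h' - g' * h"
  have w: "g * g' - g' * g = 0" "h * h' - h' * h = 0" "h * g' - h' * g = - w"
    "g * (c * g' + s * h') - g' * (c * g + s * h) = s * w"
    "(c * g + s * h) * g' - (c * g' + s * h') * g = - (s * w)"
    "(c * g + s * h) * h' - (c * g' + s * h') * h = c * w"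
    "h * (c * g' + s * h') - h' * (c * g + s * h) = - (c * w)"
    "(c * g + s * h) * (c * g' + s * h') - (c * g' + s * h') * (c * g + s * h) = 0"
    by (auto simp: w_def algebra_simps)
  have "Phi p q \<tau> (plane_block c s g g' h h') (plane_block c s g g' h h')
     = p * q * 2 * s\<^sup>2 * w\<^sup>2 - 2 * \<tau> * p * w\<^sup>2 - 2 * \<tau> * q * (c\<^sup>2 + s\<^sup>2) * w\<^sup>2 + 2 * \<tau>\<^sup>2 * w\<^sup>2
       - 2 * \<tau> * (1 - p - q + \<tau>) * w\<^sup>2"
    by (simp add: Phi_def plane_block_def polar_simps polar_sqform w w_def[symmetric])
      (simp add: power2_eq_square algebra_simps)
  also have "\<dots> = 2 * (p * q * s\<^sup>2 - \<tau>) * w\<^sup>2"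
    unfolding assms(1) by (simp add: power2_eq_square algebra_simps)
  also have "\<dots> = 2 * p * q * (1 - \<pi>) * (s * w)\<^sup>2"
    unfolding assms(2) by (simp add: power2_eq_square algebra_simps)
  finally show ?thesis by (simp add: w_def)
qed

text \<open>The value is affine in \<theta>, which will be the product of the squared sines of the
  other planes. At 0 it is a non-negatively weighted sum of two squares, at 1 a single square times
  \<open>q\<close>.\<close>

lemma Phi_plane_line:
  assumes pq: "0 \<le> p" "0 \<le> q" "p \<le> 1" and cs: "c\<^sup>2 + s\<^sup>2 = 1"
    and \<tau>: "\<tau> = p * q * s\<^sup>2 * \<theta>" and \<theta>: "0 \<le> \<theta>" "\<theta> \<le> 1"
  shows "0 \<le> Phi p q \<tau> (plane_block c s g g' h h') (line_block d d')"
proof -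
  define G H where "G = g * d' - g' * d" and "H = h * d' - h' * d"
  have GH: "(c * g + s * h) * d' - (c * g' + s * h') * d = c * G + s * H"
    by (simp add: G_def H_def algebra_simps)
  have c2: "c * c = 1 - s * s" using cs by (simp add: power2_eq_square)
  have "Phi p q \<tau> (plane_block c s g g' h h') (line_block d d')
     = p * (q - \<tau>) * G\<^sup>2 + (1 - p) * (q * (c * G + s * H)\<^sup>2 - \<tau> * (G\<^sup>2 + H\<^sup>2))"
    by (simp add: Phi_def plane_block_def line_block_def polar_simps polar_sqform GH
      G_def[symmetric] H_def[symmetric]) (simp add: power2_eq_square algebra_simps)
  also have "\<dots> = (1 - \<theta>) * (p * q * G\<^sup>2 + (1 - p) * q * (c * G + s * H)\<^sup>2)
     + \<theta> * q * (c * G + (1 - p) * s * H)\<^sup>2"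
    unfolding \<tau> power2_eq_square using c2 by Groebner_Basis.algebra
  also have "0 \<le> \<dots>" using pq \<theta> by simp
  finally show ?thesis .
qed

lemma binary_form_nonneg:
  fixes x y a b m :: real
  assumes "0 \<le> a" "0 \<le> b" "m\<^sup>2 \<le> a * b"
  shows "2 * m * (x * y) \<le> a * x\<^sup>2 + b * y\<^sup>2"
proof -
  have "\<bar>m\<bar> \<le> sqrt a * sqrt b"
    using assms real_sqrt_le_mono[of "m\<^sup>2" "a * b"] by (simp add: real_sqrt_mult)
  then have "\<bar>m\<bar> * \<bar>x * y\<bar> \<le> sqrt a * sqrt b * \<bar>x * y\<bar>" by (intro mult_right_mono) auto
  moreover have "m * (x * y) \<le> \<bar>m\<bar> * \<bar>x * y\<bar>" by (metis abs_ge_self abs_mult)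
  moreover have "0 \<le> (sqrt a * \<bar>x\<bar> - sqrt b * \<bar>y\<bar>)\<^sup>2" by simp
  then have "2 * (sqrt a * sqrt b * \<bar>x * y\<bar>) \<le> a * x\<^sup>2 + b * y\<^sup>2"
    using assms by (simp add: power2_diff power_mult_distrib abs_mult mult_ac)
  ultimately show ?thesis by linarith
qed

text \<open>The value is affine in \<open>\<theta>\<close>, so the endpoints \<open>F0\<close> and \<open>F1\<close> suffice; at \<open>\<theta> = 1\<close> it is a sum of two
  squares plus the lower bound.\<close>

lemma Phi_plane_plane:
  assumes pq: "0 \<le> p" "0 \<le> q" "p < 1" "q < 1"
    and cs: "c\<^sup>2 + s\<^sup>2 = 1" and dt: "d\<^sup>2 + t\<^sup>2 = 1"
    and \<tau>: "\<tau> = p * q * s\<^sup>2 * t\<^sup>2 * \<theta>" and \<theta>: "0 \<le> \<theta>" "\<theta> \<le> 1"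
    and C: "0 \<le> 1 - p - q + \<tau>"
  shows "2 * p * q * (c * (s * (g * h' - g' * h))) * (d * (t * (k * l' - k' * l)))
    \<le> Phi p q \<tau> (plane_block c s g g' h h') (plane_block d t k k' l l')"
proof -
  define \<omega>1 \<omega>2 \<omega>3 \<omega>4 where "\<omega>1 = g * k' - g' * k" and "\<omega>2 = g * l' - g' * l"
    and "\<omega>3 = h * k' - h' * k" and "\<omega>4 = h * l' - h' * l"
  \<comment> \<open>Minors formed from one coordinate of each plane, taken along \<open>u1\<close>,
    \<open>v\<close> instead of \<open>u1\<close>, \<open>u2\<close>.\<close>
  define x y z w where "x = \<omega>1" and "y = d * \<omega>1 + t * \<omega>2" and "z = c * \<omega>1 + s * \<omega>3"
    and "w = c * y + s * (d * \<omega>3 + t * \<omega>4)"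
  have c2: "s * s = 1 - c * c" and d2: "t * t = 1 - d * d"
    using cs dt by (simp_all add: power2_eq_square)
  have minors: "g * (d * k' + t * l') - g' * (d * k + t * l) = y"
    "(c * g + s * h) * k' - (c * g' + s * h') * k = z"
    "(c * g + s * h) * (d * k' + t * l') - (c * g' + s * h') * (d * k + t * l) = w"
    "h * (d * k' + t * l') - h' * (d * k + t * l) = d * \<omega>3 + t * \<omega>4"
    "(c * g + s * h) * l' - (c * g' + s * h') * l = c * \<omega>2 + s * \<omega>4"
    by (auto simp: x_def y_def z_def w_def \<omega>1_def \<omega>2_def \<omega>3_def \<omega>4_def algebra_simps)
  \<comment> \<open>The matrix of mixed minors is the product of the coordinate matrices of the two
    planes with a quarter turn in between. Its determinant is therefore the product of the two
    areas, and the skew coordinates contribute the factors \<open>s\<close> and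
    \<open>t\<close>.\<close>
  have det: "x * w - y * z = (s * (g * h' - g' * h)) * (t * (k * l' - k' * l))"
    unfolding x_def w_def y_def z_def \<omega>1_def \<omega>2_def \<omega>3_def \<omega>4_def by Groebner_Basis.algebra
  define F0 where "F0 = p * (1 - q) * x\<^sup>2 + q * (1 - p) * w\<^sup>2 + p * q * (y\<^sup>2 + z\<^sup>2)"
  define F1 where "F1 = p * ((1 - q) * x + q * d * y + q * c * z - q * c * d * w)\<^sup>2
    + q * ((1 - p) * w + p * c * y + p * d * z - p * c * d * x)\<^sup>2 + 2 * p * q * c * d * (x * w - y * z)"
  have "Phi p q \<tau> (plane_block c s g g' h h') (plane_block d t k k' l l')
     = F0 - \<tau> * ((1 - p - q) * (\<omega>1\<^sup>2 + \<omega>2\<^sup>2 + \<omega>3\<^sup>2 + \<omega>4\<^sup>2)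
        + p * (\<omega>1\<^sup>2 + \<omega>2\<^sup>2 + \<omega>3\<^sup>2)
        + q * (z\<^sup>2 + (c * \<omega>2 + s * \<omega>4)\<^sup>2 + y\<^sup>2 + (d * \<omega>3 + t * \<omega>4)\<^sup>2 - w\<^sup>2))"
    by (simp add: Phi_def plane_block_def polar_simps polar_sqform minors F0_def x_def
      \<omega>1_def[symmetric] \<omega>2_def[symmetric] \<omega>3_def[symmetric] \<omega>4_def[symmetric])
      (simp add: power2_eq_square algebra_simps)
  also have "\<dots> = F0 + \<theta> * (F1 - F0)"
    unfolding \<tau> F0_def F1_def x_def w_def y_def z_def power2_eq_square using c2 d2 by Groebner_Basis.algebra
  also have "\<dots> = (1 - \<theta>) * F0 + \<theta> * F1" by (simp add: algebra_simps)
  finally have Phi: "Phi p q \<tau> (plane_block c s g g' h h') (plane_block d t k k' l l')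
     = (1 - \<theta>) * F0 + \<theta> * F1" .
  let ?L = "2 * p * q * c * d * (x * w - y * z)"
  have "?L \<le> F1" unfolding F1_def using pq by simp
  \<comment> \<open>The claim splits into a form in \<open>x\<close>, \<open>w\<close> and one in
    \<open>y\<close>, \<open>z\<close>. Up to the factor \<open>p * q\<close>, the discriminant
    condition of the first is \<open>0 <= 1 - p - q + p * q * (1 - (c * d)^2)\<close>; it follows
    from \<open>C\<close> because \<open>\<tau>\<close> is at most
    \<open>p * q * (1 - (c * d)^2)\<close>.\<close>
  moreover have "?L \<le> F0"
  proof -
    have st: "s\<^sup>2 \<le> 1" "t\<^sup>2 \<le> 1"
      using cs dt by (metis le_add_same_cancel2 zero_le_power2)+
    have c2: "c\<^sup>2 = 1 - s\<^sup>2" and d2: "d\<^sup>2 = 1 - t\<^sup>2" using cs dt by simp_all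
    have "s\<^sup>2 * t\<^sup>2 * \<theta> \<le> s\<^sup>2 * t\<^sup>2" using \<theta> by (simp add: mult_left_le)
    also have "\<dots> \<le> s\<^sup>2" using st by (simp add: mult_left_le)
    also have "\<dots> \<le> 1 - (c * d)\<^sup>2"
      unfolding power_mult_distrib c2 d2 using st mult_nonneg_nonneg[of "1 - s\<^sup>2" "t\<^sup>2"]
      by (simp add: algebra_simps)
    finally have *: "s\<^sup>2 * t\<^sup>2 * \<theta> \<le> 1 - (c * d)\<^sup>2" .
    have cd: "(c * d)\<^sup>2 \<le> 1" using order_trans[OF _ *, of 0] \<theta> by simp
    have "\<tau> \<le> p * q * (1 - (c * d)\<^sup>2)"
      using mult_left_mono[OF *, of "p * q"] pq by (simp add: \<tau> mult.assoc)
    then have "0 \<le> (p * q) * (1 - p - q + p * q * (1 - (c * d)\<^sup>2))"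
      using C pq by simp
    then have "(p * q * (c * d))\<^sup>2 \<le> p * (1 - q) * (q * (1 - p))"
      by (simp add: power2_eq_square algebra_simps)
    then have "2 * (p * q * (c * d)) * (x * w) \<le> p * (1 - q) * x\<^sup>2 + q * (1 - p) * w\<^sup>2"
      using pq by (intro binary_form_nonneg) auto
    moreover have "2 * (- (c * d)) * (y * z) \<le> 1 * y\<^sup>2 + 1 * z\<^sup>2"
      using cd by (intro binary_form_nonneg) auto
    then have "p * q * (2 * (- (c * d)) * (y * z)) \<le> p * q * (1 * y\<^sup>2 + 1 * z\<^sup>2)"
      using pq by (intro mult_left_mono) auto
    ultimately show ?thesis by (simp add: F0_def algebra_simps)
  qed
  ultimately have "(1 - \<theta>) * ?L + \<theta> * ?L \<le> (1 - \<theta>) * F0 + \<theta> * F1"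
    using \<theta> by (intro add_mono mult_left_mono) auto
  then show ?thesis unfolding Phi det by (simp add: algebra_simps)
qed

section \<open>A semidefinite quadratic form in the areas\<close>

text \<open>For independent events of probability \<open>1 - s j\<close>, the left side is the
  probability that exactly one occurs, the right side that at least one does. It bounds the
  Cauchy-Schwarz factor in \<open>area_form_nonneg\<close>.\<close>

lemma sum_one_minus_prod_le:
  fixes s :: "'a \<Rightarrow> real"
  assumes "finite J" "\<And>j. j \<in> J \<Longrightarrow> 0 \<le> s j \<and> s j \<le> 1"
  shows "(\<Sum>j\<in>J. (1 - s j) * prod s (J - {j})) \<le> 1 - prod s J"
  using assms
proof (induction J)
  case (insert x J)
  have "(\<Sum>j\<in>J. (1 - s j) * prod s (insert x J - {j})) = s x * (\<Sum>j\<in>J. (1 - s j) * prod s (J - {j}))"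
    unfolding sum_distrib_left
  proof (rule sum.cong)
    fix j assume "j \<in> J"
    then have "insert x J - {j} = insert x (J - {j})" using insert.hyps by auto
    then show "(1 - s j) * prod s (insert x J - {j}) = s x * ((1 - s j) * prod s (J - {j}))"
      using insert.hyps by simp
  qed simp
  also have "\<dots> \<le> s x * (1 - prod s J)"
    using insert by (intro mult_left_mono) auto
  finally have "(\<Sum>j\<in>insert x J. (1 - s j) * prod s (insert x J - {j}))
      \<le> (1 - s x) * prod s J + s x * (1 - prod s J)"
    using insert.hyps by simp
  moreover have "0 \<le> (1 - s x) * (1 - prod s J)"
    using insert.prems by (intro mult_nonneg_nonneg) (auto intro!: prod_le_1)
  ultimately show ?case using insert.hyps by (simp add: algebra_simps)
qed simp

text \<open>Only the index with the smallest \<open>s\<close> can have a negative coefficient once the square of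
  \<open>\<Sum>i. c i * f i\<close> is split off; the other terms compensate it by Cauchy-Schwarz.\<close>

lemma area_form_nonneg:
  fixes s c f :: "'a \<Rightarrow> real"
  assumes fin: "finite I" and s: "\<And>i. i \<in> I \<Longrightarrow> 0 < s i \<and> s i < 1"
    and c: "\<And>i. i \<in> I \<Longrightarrow> (c i)\<^sup>2 = 1 - s i"
  shows "0 \<le> (\<Sum>i\<in>I. (1 - prod s (I - {i}) - (c i)\<^sup>2) * (f i)\<^sup>2) + (\<Sum>i\<in>I. c i * f i)\<^sup>2"
proof (cases "I = {}")
  case False
  then obtain m where m: "m \<in> I" and min: "\<And>j. j \<in> I \<Longrightarrow> s m \<le> s j"
    using arg_min_if_finite(1)[OF fin] arg_min_least[OF fin] by blast
  define J where "J = I - {m}"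
  have J: "finite J" "m \<notin> J" "I = insert m J" using fin m by (auto simp: J_def)
  define \<rho> where "\<rho> = prod s J"
  define r where "r j = prod s (J - {j})" for j
  define \<sigma> where "\<sigma> = (\<Sum>j\<in>J. c j * f j)"
  have r: "0 < r j" "r j \<le> 1" for j
    using s J unfolding r_def by (auto intro!: prod_pos prod_le_1 simp: less_imp_le)
  have r\<rho>: "s j * r j = \<rho>" if "j \<in> J" for j
    using that J by (simp add: \<rho>_def r_def prod.remove)
  have "prod s (I - {j}) = s m * r j" if "j \<in> J" for j
  proof -
    have "I - {j} = insert m (J - {j})" using J that by auto
    then show ?thesis using J by (simp add: r_def)
  qed
  then have "(\<Sum>j\<in>J. (1 - prod s (I - {j}) - (c j)\<^sup>2) * (f j)\<^sup>2) = (\<Sum>j\<in>J. (s j - s m * r j) * (f j)\<^sup>2)"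
    using c J by (intro sum.cong) auto
  then have eq: "(\<Sum>i\<in>I. (1 - prod s (I - {i}) - (c i)\<^sup>2) * (f i)\<^sup>2) + (\<Sum>i\<in>I. c i * f i)\<^sup>2
      = (s m - \<rho>) * (f m)\<^sup>2 + (\<Sum>j\<in>J. (s j - s m * r j) * (f j)\<^sup>2) + (c m * f m + \<sigma>)\<^sup>2"
    using J c[OF m] by (simp add: \<rho>_def \<sigma>_def)
  show ?thesis
  proof (cases "\<rho> \<le> s m")
    case True
    have "s m * r j \<le> s j" if "j \<in> J" for j
    proof -
      have "s m * r j \<le> s m" using r[of j] s[OF m] by (simp add: mult_left_le)
      also have "\<dots> \<le> s j" using min that J by auto
      finally show ?thesis .
    qed
    then show ?thesis unfolding eq using True
      by (intro add_nonneg_nonneg sum_nonneg) auto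
  next
    case False
    show ?thesis
    proof (cases "J = {}")
      case True
      \<comment> \<open>With a single index the empty product is 1 and the form vanishes
        identically.\<close>
      then show ?thesis unfolding eq
        by (simp add: \<rho>_def \<sigma>_def power_mult_distrib c[OF m] algebra_simps)
    next
      case False
      then obtain j where j: "j \<in> J" by auto
      have \<rho>1: "\<rho> < 1"
      proof -
        have sj: "0 < s j \<and> s j < 1" using s j J by auto
        then have "s j * r j \<le> s j" using r[of j] by (simp add: mult_left_le)
        then show ?thesis using sj r\<rho>[OF j] by simp
      qed
      \<comment> \<open>\<open>D\<close> links two estimates: it bounds the diagonal terms over
        \<open>J\<close> from below and, by Cauchy-Schwarz with weights \<open>r j\<close>, the
        square of \<open>\<sigma>\<close> from above.\<close>
      define D where "D = (\<Sum>j\<in>J. (f j)\<^sup>2 / r j)"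
      have "(\<rho> - s m) * ((f j)\<^sup>2 / r j) \<le> (s j - s m * r j) * (f j)\<^sup>2" if "j \<in> J" for j
      proof -
        have "s m * (r j * r j) \<le> s m * 1"
          using r[of j] s[OF m] by (intro mult_left_mono mult_le_one) auto
        then have "\<rho> - s m \<le> (s j - s m * r j) * r j"
          using r\<rho>[OF that] by (simp add: algebra_simps)
        then have "(\<rho> - s m) * ((f j)\<^sup>2 / r j) \<le> (s j - s m * r j) * r j * ((f j)\<^sup>2 / r j)"
          using r[of j] by (intro mult_right_mono) auto
        then show ?thesis using r[of j] by simp
      qed
      then have d: "(\<rho> - s m) * D \<le> (\<Sum>j\<in>J. (s j - s m * r j) * (f j)\<^sup>2)"
        unfolding D_def sum_distrib_left by (rule sum_mono)
      have "\<sigma> = (\<Sum>j\<in>J. (c j * sqrt (r j)) * (f j / sqrt (r j)))"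
        unfolding \<sigma>_def using less_imp_neq[OF r(1), THEN not_sym] by simp
      then have "\<sigma>\<^sup>2 \<le> (\<Sum>j\<in>J. (c j * sqrt (r j))\<^sup>2) * (\<Sum>j\<in>J. (f j / sqrt (r j))\<^sup>2)"
        by (simp only: Cauchy_Schwarz_ineq_sum)
      also have "(\<Sum>j\<in>J. (f j / sqrt (r j))\<^sup>2) = D"
        using r by (simp add: D_def power_divide less_imp_le)
      also have "(\<Sum>j\<in>J. (c j * sqrt (r j))\<^sup>2) = (\<Sum>j\<in>J. (1 - s j) * r j)"
        using r c J by (intro sum.cong) (auto simp: power_mult_distrib less_imp_le)
      also have "\<dots> * D \<le> (1 - \<rho>) * D"
        unfolding r_def \<rho>_def D_def using s J
        by (intro mult_right_mono sum_one_minus_prod_le sum_nonneg divide_nonneg_nonneg prod_nonneg)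
          (auto simp: less_imp_le)
      finally have \<sigma>: "\<sigma>\<^sup>2 \<le> (1 - \<rho>) * D" .
      \<comment> \<open>Completing the square in \<open>f m\<close>, whose square has coefficient
        \<open>s m - \<rho> + (c m)^2 = 1 - \<rho>\<close>. The leftover multiple of
        \<open>\<sigma>^2\<close> is then traded for \<open>D\<close>.\<close>
      have "0 \<le> ((1 - \<rho>) * f m + c m * \<sigma>)\<^sup>2" by simp
      also have "\<dots> = (1 - \<rho>) * ((s m - \<rho>) * (f m)\<^sup>2 + (c m * f m + \<sigma>)\<^sup>2) + (\<rho> - s m) * \<sigma>\<^sup>2"
        using c[OF m] unfolding power2_eq_square by Groebner_Basis.algebra
      also have "\<dots> \<le> (1 - \<rho>) * ((s m - \<rho>) * (f m)\<^sup>2 + (c m * f m + \<sigma>)\<^sup>2)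
          + (\<rho> - s m) * ((1 - \<rho>) * D)"
        using \<sigma> \<open>\<not> \<rho> \<le> s m\<close> by (intro add_left_mono mult_left_mono) auto
      also have "\<dots> = (1 - \<rho>) * ((s m - \<rho>) * (f m)\<^sup>2 + (\<rho> - s m) * D + (c m * f m + \<sigma>)\<^sup>2)"
        by (simp add: algebra_simps)
      finally have "0 \<le> (s m - \<rho>) * (f m)\<^sup>2 + (\<rho> - s m) * D + (c m * f m + \<sigma>)\<^sup>2"
        using \<rho>1 by (simp add: zero_le_mult_iff)
      then show ?thesis unfolding eq using d by linarith
    qed
  qed
qed simp

text \<open>Bilinearity splits the value into plane-plane, plane-line and line-line sums. The first
  dominates \<open>2 * p * q\<close> times the form of \<open>area_form_nonneg\<close>, taken with
  weights \<open>(s i)^2\<close>.\<close>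

lemma Phi_blocks_nonneg:
  fixes c s g g' h h' d d' :: "nat \<Rightarrow> real" and p q \<tau> :: real and k n :: nat
  defines "V \<equiv> (\<Sum>i<k. plane_block (c i) (s i) (g i) (g' i) (h i) (h' i))
    + (\<Sum>l<n. line_block (d l) (d' l))"
  assumes pq: "0 \<le> p" "0 \<le> q" "p < 1" "q < 1"
    and cs: "\<And>i. i < k \<Longrightarrow> (c i)\<^sup>2 + (s i)\<^sup>2 = 1"
    and s: "\<And>i. i < k \<Longrightarrow> 0 < (s i)\<^sup>2 \<and> (s i)\<^sup>2 < 1"
    and \<tau>: "\<tau> = p * q * (\<Prod>i<k. (s i)\<^sup>2)" and C: "0 \<le> 1 - p - q + \<tau>"
  shows "0 \<le> Phi p q \<tau> V V"
proof -
  define v where "v i = plane_block (c i) (s i) (g i) (g' i) (h i) (h' i)" for i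
  define w where "w l = line_block (d l) (d' l)" for l
  define f where "f i = s i * (g i * h' i - g' i * h i)" for i
  define \<pi> where "\<pi> I = (\<Prod>i\<in>I. (s i)\<^sup>2)" for I
  have \<pi>: "0 \<le> \<pi> I" "\<pi> I \<le> 1" if "I \<subseteq> {..<k}" for I
    unfolding \<pi>_def using s that by (auto intro!: prod_nonneg prod_le_1 simp: less_imp_le subset_eq)
  note bil = bilinear_Phi[of p q \<tau>]
  \<comment> \<open>Removing the factors of the planes at hand leaves the parameter
    \<open>\<pi>\<close> or \<open>\<theta>\<close> of the block lemmas.\<close>
  have split1: "\<pi> {..<k} = (s i)\<^sup>2 * \<pi> ({..<k} - {i})" if "i < k" for i
    unfolding \<pi>_def using that by (intro prod.remove) auto
  have split2: "\<pi> {..<k} = (s i)\<^sup>2 * (s j)\<^sup>2 * \<pi> ({..<k} - {i} - {j})" if "i < k" "j < k" "i \<noteq> j" for i j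
    unfolding split1[OF that(1)] unfolding \<pi>_def using that
    by (subst prod.remove[of _ j]) auto
  have \<tau>0: "0 \<le> \<tau>" unfolding \<tau> using pq \<pi>(1)[of "{..<k}"] by (simp add: \<pi>_def)
  have "p * (q * \<pi> {..<k}) \<le> 1 * (q * 1)"
    using pq \<pi>[of "{..<k}"] by (intro mult_mono) auto
  then have \<tau>q: "\<tau> \<le> q" by (simp add: \<tau> \<pi>_def mult.assoc)
  have diag: "Phi p q \<tau> (v i) (v i) = 2 * p * q * (1 - \<pi> ({..<k} - {i})) * (f i)\<^sup>2" if "i < k" for i
    unfolding v_def f_def using that split1[OF that] cs
    by (intro Phi_plane_self) (auto simp: \<tau> \<pi>_def)
  have off: "2 * p * q * (c i * f i) * (c j * f j) \<le> Phi p q \<tau> (v i) (v j)"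
    if "i < k" "j < k" "i \<noteq> j" for i j
    unfolding v_def f_def
    by (rule Phi_plane_plane[where \<theta> = "\<pi> ({..<k} - {i} - {j})"])
      (use that split2[OF that] cs pq \<pi>[of "{..<k} - {i} - {j}"] C in \<open>auto simp: \<tau> \<pi>_def\<close>)
  have vw: "0 \<le> Phi p q \<tau> (v i) (w l)" if "i < k" for i l
    unfolding v_def w_def
    by (rule Phi_plane_line[where \<theta> = "\<pi> ({..<k} - {i})"])
      (use that split1[OF that] cs pq \<pi> in \<open>auto simp: \<tau> \<pi>_def\<close>)
  have ww: "0 \<le> Phi p q \<tau> (w l) (w m)" for l m
    unfolding w_def using \<tau>0 \<tau>q C by (rule Phi_line_line)
  have "0 \<le> 2 * p * q * ((\<Sum>i<k. (1 - \<pi> ({..<k} - {i}) - (c i)\<^sup>2) * (f i)\<^sup>2) + (\<Sum>i<k. c i * f i)\<^sup>2)"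
    unfolding \<pi>_def using pq s cs
    by (intro mult_nonneg_nonneg area_form_nonneg) (auto simp: algebra_simps)
  also have "\<dots> = (\<Sum>i<k. \<Sum>j<k. 2 * p * q * (c i * f i) * (c j * f j)
       + (if i = j then 2 * p * q * (1 - \<pi> ({..<k} - {i}) - (c i)\<^sup>2) * (f i)\<^sup>2 else 0))"
    by (simp add: sum.distrib power2_eq_square[of "sum _ _"] sum_product sum_distrib_left distrib_left mult_ac)
  \<comment> \<open>On the diagonal the term \<open>(c i * f i)^2\<close> of the expanded square
    cancels the subtracted \<open>(c i)^2\<close>, leaving exactly \<open>diag\<close>; elsewhere
    \<open>off\<close> applies.\<close>
  also have "\<dots> \<le> (\<Sum>i<k. \<Sum>j<k. Phi p q \<tau> (v i) (v j))"
  proof (intro sum_mono)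
    fix i j assume "i \<in> {..<k}" "j \<in> {..<k}"
    then show "2 * p * q * (c i * f i) * (c j * f j)
       + (if i = j then 2 * p * q * (1 - \<pi> ({..<k} - {i}) - (c i)\<^sup>2) * (f i)\<^sup>2 else 0) \<le> Phi p q \<tau> (v i) (v j)"
      using off[of i j] diag[of i] by (cases "i = j") (auto simp: power2_eq_square algebra_simps)
  qed
  also have "\<dots> = Phi p q \<tau> (\<Sum>i<k. v i) (\<Sum>i<k. v i)"
    by (simp add: bilinear_sum[OF bil] sum.cartesian_product)
  finally have 1: "0 \<le> Phi p q \<tau> (\<Sum>i<k. v i) (\<Sum>i<k. v i)" .
  have 2: "0 \<le> Phi p q \<tau> (\<Sum>i<k. v i) (\<Sum>l<n. w l)"
    unfolding bilinear_sum[OF bil] using vw by (intro sum_nonneg) auto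
  have 3: "0 \<le> Phi p q \<tau> (\<Sum>l<n. w l) (\<Sum>l<n. w l)"
    unfolding bilinear_sum[OF bil] using ww by (intro sum_nonneg) auto
  have "Phi p q \<tau> V V = Phi p q \<tau> (\<Sum>i<k. v i) (\<Sum>i<k. v i) + 2 * Phi p q \<tau> (\<Sum>i<k. v i) (\<Sum>l<n. w l)
     + Phi p q \<tau> (\<Sum>l<n. w l) (\<Sum>l<n. w l)"
    unfolding V_def v_def[symmetric] w_def[symmetric]
    by (simp add: bilinear_ladd[OF bil] bilinear_radd[OF bil] Phi_commute[of p q \<tau> "\<Sum>l<n. w l" "\<Sum>i<k. v i"])
  then show ?thesis using 1 2 3 by simp
qed

subsection \<open>Wedge products and principal angles\<close>

definition gram_form :: "'a::real_inner \<Rightarrow> 'a \<Rightarrow> form" where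
  "gram_form y z = (inner y y, inner y z, inner z z)"

lemma det_2_2:
  assumes A: "A \<in> carrier_mat 2 2"
  shows "Determinant.det A = A $$ (0, 0) * A $$ (1, 1) - A $$ (0, 1) * A $$ (1, 0)"
proof -
  have "Determinant.det (mat_delete A 0 j) = A $$ (1, 1 - j)" if "j < 2" for j
    using A that by (subst det_single) (auto simp: mat_delete_def less_2_cases_iff)
  then show ?thesis
    by (simp add: laplace_expansion_row[OF A, of 0] cofactor_def numeral_2_eq_2)
qed

lemma wedge_inner_pair: "wedge_inner [y, z] [y, z] = polar (gram_form y z) (gram_form y z) / 2"
  using det_2_2[of "Matrix.mat 2 2 (\<lambda>(s, t). inner ([y, z] ! s) ([y, z] ! t))"]
  by (simp add: wedge_inner_def numeral_2_eq_2 polar_def gram_form_def inner_commute)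

text \<open>Replacing \<open>y\<close>, \<open>z\<close> by their components orthogonal to \<open>bs\<close> does not change the product.\<close>

lemma wedge_inner_pair_append_orthonormal:
  fixes y z :: "'a::real_inner"
  assumes on: "orthonormal_list bs"
  defines "P \<equiv> gram_form y z - (\<Sum>j<length bs. sqform (inner y (bs ! j)) (inner z (bs ! j)))"
  shows "wedge_inner ([y, z] @ bs) ([y, z] @ bs) = polar P P / 2"
proof -
  define n where "n = length bs"
  define pr where "pr w = w - (\<Sum>j<n. inner w (bs ! j) *\<^sub>R bs ! j)" for w
  have bs: "inner (bs ! i) (bs ! j) = (if i = j then 1 else 0)" if "i < n" "j < n" for i j
    using on that by (simp add: orthonormal_list_def n_def)
  have pr_orth: "inner (pr w) (bs ! j) = 0" "inner (bs ! j) (pr w) = 0" if "j < n" for w j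
    using that by (auto simp: pr_def inner_diff_left inner_diff_right inner_sum_left inner_sum_right bs
        if_distrib[of "(*) _"] inner_commute cong: if_cong)
  have pr_inner: "inner (pr w) (pr w') = inner w w' - (\<Sum>j<n. inner w (bs ! j) * inner w' (bs ! j))" for w w'
  proof -
    have "inner (pr w) (pr w') = inner (pr w) w'"
      by (subst (2) pr_def) (simp add: inner_diff_right inner_sum_right pr_orth)
    then show ?thesis by (simp add: pr_def inner_diff_left inner_sum_left inner_commute[of w'])
  qed
  have P: "P = gram_form (pr y) (pr z)"
    by (simp add: P_def gram_form_def pr_inner n_def[symmetric] prod_eq_iff fst_sum snd_sum sqform_def)
  \<comment> \<open>Subtracting the projections is a unipotent block triangular substitution, hence
    of determinant 1.\<close>
  define A where "A = four_block_mat (1\<^sub>m 2)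
    (Matrix.mat 2 n (\<lambda>(i, j). - inner ([y, z] ! i) (bs ! j))) (0\<^sub>m n 2) (1\<^sub>m n)"
  have A: "A \<in> carrier_mat (2 + n) (2 + n)"
    unfolding A_def by (intro four_block_carrier_mat) auto
  have detA: "Determinant.det A = 1"
    unfolding A_def by (subst det_four_block_mat_lower_left_zero[of _ 2 _ n]) auto
  have "([pr y, pr z] @ bs) ! i = (\<Sum>j<2 + n. A $$ (i, j) *\<^sub>R ([y, z] @ bs) ! j)" if i: "i < 2 + n" for i
  proof -
    have [simp]: "[a, b] ! (0::nat) = (a :: 'a)" "[a, b] ! 1 = b" for a b by simp_all
    consider "i = 0" | "i = 1" | "2 \<le> i" by linarith
    then show ?thesis
      unfolding sum_lessThan_add using i
      by cases (auto simp: A_def numeral_2_eq_2 pr_def n_def sum_negf scaleR_minus_left nth_append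
         nth_Cons' if_distrib[of "\<lambda>a. a *\<^sub>R _"] cong: if_cong)
  qed
  then have "wedge_inner ([pr y, pr z] @ bs) ([pr y, pr z] @ bs) = wedge_inner ([y, z] @ bs) ([y, z] @ bs)"
    using wedge_inner_linear_image[OF A, of "[y, z] @ bs" "[pr y, pr z] @ bs"] detA
    by (simp add: n_def)
  moreover have "wedge_inner ([pr y, pr z] @ bs) ([pr y, pr z] @ bs) = wedge_inner [pr y, pr z] [pr y, pr z]"
  proof -
    define G where "G = Matrix.mat 2 2 (\<lambda>(s, t). inner ([pr y, pr z] ! s) ([pr y, pr z] ! t))"
    have "Matrix.mat (2 + n) (2 + n) (\<lambda>(s, t). inner (([pr y, pr z] @ bs) ! s) (([pr y, pr z] @ bs) ! t))
      = four_block_mat G (0\<^sub>m 2 n) (0\<^sub>m n 2) (1\<^sub>m n)"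
    proof (rule eq_matI, goal_cases)
      case (1 s t)
      then show ?case
        by (auto simp: nth_append G_def bs pr_orth nth_Cons' less_Suc_eq numeral_2_eq_2)
    qed (auto simp: G_def)
    moreover have "Determinant.det (four_block_mat G (0\<^sub>m 2 n) (0\<^sub>m n 2) (1\<^sub>m n)) = Determinant.det G"
      by (subst det_four_block_mat_lower_left_zero[of _ 2 _ n]) (auto simp: G_def)
    ultimately show ?thesis by (simp add: wedge_inner_def n_def G_def numeral_2_eq_2)
  qed
  ultimately show ?thesis by (simp add: P wedge_inner_pair)
qed

text \<open>Over \<open>u\<close>, \<open>u'\<close>, \<open>w\<close> the list has a lower
  triangular matrix with the sines on the diagonal at the places of \<open>v\<close>. In Case II
  this computes the product of the orthonormal bases of the two spans.\<close>

lemma wedge_inner_rotated: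
  fixes u u' v w :: "nat \<Rightarrow> 'a::real_inner"
  assumes on: "orthonormal_list (fam u k @ fam u' k @ fam w m)"
    and v: "\<And>i. i < k \<Longrightarrow> v i = cos (\<alpha> i) *\<^sub>R u i + sin (\<alpha> i) *\<^sub>R u' i"
  shows "wedge_inner (fam u k @ fam v k @ fam w m) (fam u k @ fam v k @ fam w m)
    = (\<Prod>i<k. (sin (\<alpha> i))\<^sup>2)"
proof -
  let ?N = "k + (k + m)"
  define A where "A = Matrix.mat ?N ?N (\<lambda>(i, j).
    if i = j then if k \<le> i \<and> i < k + k then sin (\<alpha> (i - k)) else 1
    else if k \<le> i \<and> i < k + k \<and> j = i - k then cos (\<alpha> (i - k)) else 0)"
  have A: "A \<in> carrier_mat ?N ?N" by (simp add: A_def)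
  have "Determinant.det A = (\<Prod>i<?N. A $$ (i, i))"
    using A by (subst det_lower_triangular[OF _ A])
      (auto simp: A_def prod_list_diag_prod atLeast0LessThan)
  also have "\<dots> = (\<Prod>i<?N. if k \<le> i \<and> i < k + k then sin (\<alpha> (i - k)) else 1)"
    by (intro prod.cong) (auto simp: A_def)
  also have "\<dots> = (\<Prod>i\<in>{k..<k + k}. sin (\<alpha> (i - k)))"
    by (subst prod.inter_filter[symmetric]) (auto intro!: prod.cong)
  also have "\<dots> = (\<Prod>i<k. sin (\<alpha> i))"
    using prod.shift_bounds_nat_ivl[of "\<lambda>i. sin (\<alpha> (i - k))" 0 k k] by (simp add: atLeast0LessThan)
  finally have detA: "Determinant.det A = (\<Prod>i<k. sin (\<alpha> i))" .
  have "(fam u k @ fam v k @ fam w m) ! i = (\<Sum>j<?N. A $$ (i, j) *\<^sub>R (fam u k @ fam u' k @ fam w m) ! j)"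
    if i: "i < ?N" for i
  proof -
    let ?x = "fam u k @ fam u' k @ fam w m"
    \<comment> \<open>Row \<open>i\<close> has at most two non-zero entries. For
      \<open>i < k\<close> truncated subtraction turns \<open>i - k\<close> into 0, but the guard
      removes that term.\<close>
    have "(\<Sum>j<?N. A $$ (i, j) *\<^sub>R ?x ! j)
      = (\<Sum>j<?N. (if j = i then (if k \<le> i \<and> i < k + k then sin (\<alpha> (i - k)) else 1) *\<^sub>R ?x ! i else 0)
         + (if j = i - k then (if k \<le> i \<and> i < k + k then cos (\<alpha> (i - k)) *\<^sub>R ?x ! (i - k) else 0) else 0))"
      using i by (intro sum.cong) (auto simp: A_def)
    also have "\<dots> = (if k \<le> i \<and> i < k + k then sin (\<alpha> (i - k)) else 1) *\<^sub>R ?x ! i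
         + (if k \<le> i \<and> i < k + k then cos (\<alpha> (i - k)) *\<^sub>R ?x ! (i - k) else 0)"
      using i less_imp_diff_less[OF i, of k] by (simp add: sum.distrib)
    also have "\<dots> = (fam u k @ fam v k @ fam w m) ! i"
      using i by (auto simp: nth_append v)
    finally show ?thesis by simp
  qed
  then show ?thesis
    by (subst wedge_inner_linear_image[OF A, of "fam u k @ fam u' k @ fam w m"])
      (auto simp: detA wedge_inner_orthonormal[OF on] prod_power_distrib)
qed

lemma wedge_inner_repeated:
  assumes "\<not> distinct xs" shows "wedge_inner xs xs = 0"
proof -
  obtain i j where ij: "i < length xs" "j < length xs" "i \<noteq> j" "xs ! i = xs ! j"
    using assms by (auto simp: distinct_conv_nth)
  then show ?thesis
    unfolding wedge_inner_def
    by (simp, intro det_identical_rows[of _ "length xs" i j]) (auto intro!: eq_vecI)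
qed

lemma polar_sum_sqform_nonneg:
  "0 \<le> polar (\<Sum>i\<in>I. sqform (f i) (g i)) (\<Sum>j\<in>J. sqform (f' j) (g' j))"
  by (simp add: bilinear_sum[OF bilinear_polar] polar_sqform sum_nonneg split_def)

section \<open>Coordinates in the adapted orthonormal basis\<close>

lemma inner_lin_comb:
  assumes "orthonormal_list (fam u m)"
  shows "inner (lin_comb m f u) (lin_comb m g u) = (\<Sum>i<m. f i * g i)"
proof -
  have "inner (lin_comb m f u) (lin_comb m g u) = (\<Sum>i<m. \<Sum>j<m. if j = i then f i * g i else 0)"
    unfolding lin_comb_def inner_sum_left inner_sum_right using assms
    by (subst sum.swap, intro sum.cong) (auto simp: orthonormal_fam)
  then show ?thesis by simp
qed

lemma inner_lin_comb_orthogonal: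
  assumes "\<forall>x\<in>set (fam u m). \<forall>y\<in>set (fam w n). inner x y = 0"
  shows "inner (lin_comb m f u) (lin_comb n g w) = 0" "inner (lin_comb n g w) (lin_comb m f u) = 0"
proof -
  show "inner (lin_comb m f u) (lin_comb n g w) = 0"
    unfolding lin_comb_def inner_sum_left inner_sum_right using assms
    by (intro sum.neutral ballI) auto
  then show "inner (lin_comb n g w) (lin_comb m f u) = 0" by (simp add: inner_commute)
qed

lemma lin_comb_unit: "i < m \<Longrightarrow> lin_comb m (\<lambda>j. if j = i then 1 else 0) u = u i"
  by (simp add: lin_comb_def if_distrib[of "\<lambda>a. a *\<^sub>R _"] cong: if_cong)

lemma lin_comb_scaleR: "r *\<^sub>R lin_comb m f u = lin_comb m (\<lambda>i. r * f i) u"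
  by (simp add: lin_comb_def scaleR_sum_right)

lemma lin_comb_zero: "lin_comb m (\<lambda>i. 0) u = 0"
  by (simp add: lin_comb_def)

lemma inner_lin_comb5:
  fixes u1 u2 u3 u4 u5 :: "nat \<Rightarrow> 'a::real_inner" and k k3 k4 k5 :: nat
  defines "Y f1 f2 f3 f4 f5 \<equiv> lin_comb k f1 u1 + lin_comb k f2 u2 + lin_comb k3 f3 u3
    + lin_comb k4 f4 u4 + lin_comb k5 f5 u5"
  assumes on: "orthonormal_list (fam u1 k @ fam u2 k @ fam u3 k3 @ fam u4 k4 @ fam u5 k5)"
  shows "inner (Y f1 f2 f3 f4 f5) (Y g1 g2 g3 g4 g5)
      = (\<Sum>i<k. f1 i * g1 i + f2 i * g2 i) + (\<Sum>i<k3. f3 i * g3 i) + (\<Sum>i<k4. f4 i * g4 i)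
        + (\<Sum>i<k5. f5 i * g5 i)"
    and "i < k \<Longrightarrow> inner (Y f1 f2 f3 f4 f5) (u1 i) = f1 i"
    and "i < k \<Longrightarrow> inner (Y f1 f2 f3 f4 f5) (u2 i) = f2 i"
    and "i < k3 \<Longrightarrow> inner (Y f1 f2 f3 f4 f5) (u3 i) = f3 i"
    and "i < k4 \<Longrightarrow> inner (Y f1 f2 f3 f4 f5) (u4 i) = f4 i"
proof -
  have on1: "orthonormal_list (fam u1 k)" "orthonormal_list (fam u2 k)" "orthonormal_list (fam u3 k3)"
      "orthonormal_list (fam u4 k4)" "orthonormal_list (fam u5 k5)"
    and on2:
      "\<forall>x\<in>set (fam u1 k). \<forall>y\<in>set (fam u2 k). inner x y = 0"
      "\<forall>x\<in>set (fam u1 k). \<forall>y\<in>set (fam u3 k3). inner x y = 0"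
      "\<forall>x\<in>set (fam u1 k). \<forall>y\<in>set (fam u4 k4). inner x y = 0"
      "\<forall>x\<in>set (fam u1 k). \<forall>y\<in>set (fam u5 k5). inner x y = 0"
      "\<forall>x\<in>set (fam u2 k). \<forall>y\<in>set (fam u3 k3). inner x y = 0"
      "\<forall>x\<in>set (fam u2 k). \<forall>y\<in>set (fam u4 k4). inner x y = 0"
      "\<forall>x\<in>set (fam u2 k). \<forall>y\<in>set (fam u5 k5). inner x y = 0"
      "\<forall>x\<in>set (fam u3 k3). \<forall>y\<in>set (fam u4 k4). inner x y = 0"
      "\<forall>x\<in>set (fam u3 k3). \<forall>y\<in>set (fam u5 k5). inner x y = 0"
      "\<forall>x\<in>set (fam u4 k4). \<forall>y\<in>set (fam u5 k5). inner x y = 0"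
    using on unfolding orthonormal_list_append set_append by blast+
  note orth = on2[THEN inner_lin_comb_orthogonal(1)] on2[THEN inner_lin_comb_orthogonal(2)]
  show inner: "inner (Y f1 f2 f3 f4 f5) (Y g1 g2 g3 g4 g5)
      = (\<Sum>i<k. f1 i * g1 i + f2 i * g2 i) + (\<Sum>i<k3. f3 i * g3 i) + (\<Sum>i<k4. f4 i * g4 i)
        + (\<Sum>i<k5. f5 i * g5 i)" for f1 f2 f3 f4 f5 g1 g2 g3 g4 g5
    unfolding Y_def inner_add_left inner_add_right orth on1[THEN inner_lin_comb]
    by (simp add: sum.distrib)
  let ?e = "\<lambda>i j. if j = i then 1 else 0 :: real" and ?z = "\<lambda>j. 0 :: real"
  have "Y (?e i) ?z ?z ?z ?z = u1 i" "Y ?z (?e i) ?z ?z ?z = u2 i" if "i < k" for i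
    using that by (simp_all add: Y_def lin_comb_zero lin_comb_unit)
  moreover have "Y ?z ?z (?e i) ?z ?z = u3 i" if "i < k3" for i
    using that by (simp add: Y_def lin_comb_zero lin_comb_unit)
  moreover have "Y ?z ?z ?z (?e i) ?z = u4 i" if "i < k4" for i
    using that by (simp add: Y_def lin_comb_zero lin_comb_unit)
  ultimately show
    "i < k \<Longrightarrow> inner (Y f1 f2 f3 f4 f5) (u1 i) = f1 i"
    "i < k \<Longrightarrow> inner (Y f1 f2 f3 f4 f5) (u2 i) = f2 i"
    "i < k3 \<Longrightarrow> inner (Y f1 f2 f3 f4 f5) (u3 i) = f3 i"
    "i < k4 \<Longrightarrow> inner (Y f1 f2 f3 f4 f5) (u4 i) = f4 i"
    using inner[of f1 f2 f3 f4 f5 "?e i" ?z ?z ?z ?z] inner[of f1 f2 f3 f4 f5 ?z "?e i" ?z ?z ?z]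
      inner[of f1 f2 f3 f4 f5 ?z ?z "?e i" ?z ?z] inner[of f1 f2 f3 f4 f5 ?z ?z ?z "?e i" ?z]
    by (simp_all add: if_distrib[of "(*) _"] cong: if_cong)
qed

lemma gram_form_lin_comb5:
  fixes u1 u2 u3 u4 u5 :: "nat \<Rightarrow> 'a::real_inner" and k k3 k4 k5 :: nat
  defines "Y f1 f2 f3 f4 f5 \<equiv> lin_comb k f1 u1 + lin_comb k f2 u2 + lin_comb k3 f3 u3
    + lin_comb k4 f4 u4 + lin_comb k5 f5 u5"
  assumes on: "orthonormal_list (fam u1 k @ fam u2 k @ fam u3 k3 @ fam u4 k4 @ fam u5 k5)"
  shows "gram_form (Y f1 f2 f3 f4 f5) (Y g1 g2 g3 g4 g5)
      = (\<Sum>i<k. sqform (f1 i) (g1 i) + sqform (f2 i) (g2 i)) + (\<Sum>i<k3. sqform (f3 i) (g3 i))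
        + (\<Sum>i<k4. sqform (f4 i) (g4 i)) + (\<Sum>i<k5. sqform (f5 i) (g5 i))"
  unfolding Y_def gram_form_def inner_lin_comb5[OF on]
  by (simp add: prod_eq_iff fst_sum snd_sum sqform_def)

text \<open>Compare coefficients in \<open>a\<close>, \<open>b\<close>: both sides have
  \<open>1 - q * (sin \<alpha>)^2\<close> at \<open>a * a'\<close>,
  \<open>1 - p * (sin \<alpha>)^2\<close> at \<open>b * b'\<close> and \<open>cos \<alpha>\<close>
  at the mixed terms. The angle \<open>\<alpha>'\<close> is made for the last of these; its sine
  enters only through the Pythagorean identity.\<close>

lemma sqform_tilde:
  fixes \<alpha> \<alpha>' p q a b a' b' :: real
  defines "g \<equiv> a + b * cos \<alpha>" and "g' \<equiv> a' + b' * cos \<alpha>" and "h \<equiv> b * sin \<alpha>" and "h' \<equiv> b' * sin \<alpha>"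
  defines "\<delta> \<equiv> sqrt (delta p \<alpha>)" and "\<epsilon> \<equiv> sqrt (delta q \<alpha>)"
  assumes pos: "0 < delta p \<alpha>" "0 < delta q \<alpha>"
    and cos: "cos \<alpha>' = cos \<alpha> / sqrt (delta p \<alpha> * delta q \<alpha>)"
  shows "sqform (a * \<epsilon> + b * \<delta> * cos \<alpha>') (a' * \<epsilon> + b' * \<delta> * cos \<alpha>')
      + sqform (b * \<delta> * sin \<alpha>') (b' * \<delta> * sin \<alpha>')
    = (1 - p - q) *\<^sub>R (sqform g g' + sqform h h') + p *\<^sub>R sqform g g'
      + q *\<^sub>R sqform (cos \<alpha> * g + sin \<alpha> * h) (cos \<alpha> * g' + sin \<alpha> * h')"
proof -
  have cs: "cos \<alpha> * cos \<alpha> = 1 - sin \<alpha> * sin \<alpha>" "cos \<alpha>' * cos \<alpha>' = 1 - sin \<alpha>' * sin \<alpha>'"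
    using sin_cos_squared_add3[of \<alpha>] sin_cos_squared_add3[of \<alpha>'] by linarith+
  have \<delta>: "\<delta> * \<delta> = 1 - p * (sin \<alpha> * sin \<alpha>)" and \<epsilon>: "\<epsilon> * \<epsilon> = 1 - q * (sin \<alpha> * sin \<alpha>)"
    using pos by (simp_all add: \<delta>_def \<epsilon>_def delta_def power2_eq_square)
  have \<delta>\<epsilon>: "\<delta> * \<epsilon> * cos \<alpha>' = cos \<alpha>"
    using pos by (simp add: cos \<delta>_def \<epsilon>_def real_sqrt_mult)
  have "(x * \<epsilon> + y * \<delta> * cos \<alpha>') * (x' * \<epsilon> + y' * \<delta> * cos \<alpha>') + y * \<delta> * sin \<alpha>' * (y' * \<delta> * sin \<alpha>')
     = (1 - p - q) * ((x + y * cos \<alpha>) * (x' + y' * cos \<alpha>) + y * sin \<alpha> * (y' * sin \<alpha>))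
       + p * ((x + y * cos \<alpha>) * (x' + y' * cos \<alpha>))
       + q * ((cos \<alpha> * (x + y * cos \<alpha>) + sin \<alpha> * (y * sin \<alpha>)) * (cos \<alpha> * (x' + y' * cos \<alpha>) + sin \<alpha> * (y' * sin \<alpha>)))"
    for x x' y y'
  proof -
    have "(x * \<epsilon> + y * \<delta> * cos \<alpha>') * (x' * \<epsilon> + y' * \<delta> * cos \<alpha>') + y * \<delta> * sin \<alpha>' * (y' * \<delta> * sin \<alpha>')
       = x * x' * (\<epsilon> * \<epsilon>) + y * y' * (\<delta> * \<delta>) * (cos \<alpha>' * cos \<alpha>' + sin \<alpha>' * sin \<alpha>')
         + (x * y' + x' * y) * (\<delta> * \<epsilon> * cos \<alpha>')"
      by (simp add: algebra_simps del: sin_cos_squared_add3)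
    also have "\<dots> = x * x' * (1 - q * (1 - cos \<alpha> * cos \<alpha>)) + y * y' * (1 - p * (sin \<alpha> * sin \<alpha>))
         + (x * y' + x' * y) * cos \<alpha>"
      unfolding \<delta> \<epsilon> \<delta>\<epsilon> cs by simp
    also have "\<dots> = (1 - p - q) * (x * x' + (x * y' + x' * y) * cos \<alpha> + y * y' * (cos \<alpha> * cos \<alpha> + sin \<alpha> * sin \<alpha>))
       + p * ((x + y * cos \<alpha>) * (x' + y' * cos \<alpha>))
       + q * ((x * cos \<alpha> + y * (cos \<alpha> * cos \<alpha> + sin \<alpha> * sin \<alpha>)) * (x' * cos \<alpha> + y' * (cos \<alpha> * cos \<alpha> + sin \<alpha> * sin \<alpha>)))"
      by (simp add: algebra_simps cs(1) del: sin_cos_squared_add3)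
    finally show ?thesis by (simp add: algebra_simps del: sin_cos_squared_add3)
  qed
  then show ?thesis
    by (simp add: sqform_def g_def g'_def h_def h'_def)
qed

theorem theorem2:
  fixes E1 E2 :: "(real ^ 'p) set"
    and es1 es2 :: "(real ^ 'p) list"
    and k1 k2 k k3 k4 k5 :: nat
    and \<kappa>1 \<kappa>2 :: real
    and u1 u2 u3 u4 u5 v :: "nat \<Rightarrow> real ^ 'p"
    and \<alpha> \<alpha>' :: "nat \<Rightarrow> real"
    and a b c d e a' b' c' d' e' :: "nat \<Rightarrow> real"
    and y y' yI yI' yII yII' :: "real ^ 'p"
    and P :: real
  assumes E1: "finite E1" "card E1 = k1" "k1 < CARD('p)"
    and E2: "finite E2" "card E2 = k2" "k2 < CARD('p)"
    and "k1 \<le> k2"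
    and es1: "distinct es1" "set es1 = E1"
    and es2: "distinct es2" "set es2 = E2"
    and \<kappa>1: "\<kappa>1 = (wedge_norm es1)\<^sup>2" "0 < \<kappa>1" "\<kappa>1 < 1"
    and \<kappa>2: "\<kappa>2 = (wedge_norm es2)\<^sup>2" "0 < \<kappa>2" "\<kappa>2 < 1"
    and \<kappa>12: "0 < 1 - \<kappa>1 - \<kappa>2 + (wedge_norm (es1 @ es2))\<^sup>2"
      "1 - \<kappa>1 - \<kappa>2 + (wedge_norm (es1 @ es2))\<^sup>2 < 1"
    and dims: "k + k3 = k1" "k + k3 + k4 = k2" "2 * k + k3 + k4 + k5 = CARD('p)"
    and u_orthonormal: "orthonormal_list (fam u1 k @ fam u2 k @ fam u3 k3 @ fam u4 k4 @ fam u5 k5)"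
    and u_basis: "is_basis_of (fam u1 k @ fam u2 k @ fam u3 k3 @ fam u4 k4 @ fam u5 k5) UNIV"
    and \<alpha>: "\<And>i. i < k \<Longrightarrow> 0 < \<alpha> i \<and> \<alpha> i < pi / 2"
    and v: "\<And>i. i < k \<Longrightarrow> v i = cos (\<alpha> i) *\<^sub>R u1 i + sin (\<alpha> i) *\<^sub>R u2 i"
    and basis_E1: "is_basis_of (fam u1 k @ fam u3 k3) (span E1)"
    and basis_E2: "is_basis_of (fam v k @ fam u3 k3 @ fam u4 k4) (span E2)"
    and \<alpha>': "\<And>i. i < k \<Longrightarrow> 0 < \<alpha>' i \<and> \<alpha>' i < pi / 2"
      "\<And>i. i < k \<Longrightarrow> cos (\<alpha>' i) = cos (\<alpha> i) / sqrt (delta \<kappa>1 (\<alpha> i) * delta \<kappa>2 (\<alpha> i))"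
      "\<And>i. i < k \<Longrightarrow> sin (\<alpha>' i) =
         sin (\<alpha> i) * sqrt (1 - \<kappa>1 - \<kappa>2 + \<kappa>1 * \<kappa>2 * (sin (\<alpha> i))\<^sup>2)
           / sqrt (delta \<kappa>1 (\<alpha> i) * delta \<kappa>2 (\<alpha> i))"
    and P: "P = (\<Prod>i<k. (sin (\<alpha> i))\<^sup>2)"
    and "y \<noteq> y'"
    and y: "y = y_zero k \<alpha> u1 u2 a b + lin_comb k3 c u3 + lin_comb k4 d u4 + lin_comb k5 e u5"
    and y': "y' = y_zero k \<alpha> u1 u2 a' b' + lin_comb k3 c' u3 + lin_comb k4 d' u4 + lin_comb k5 e' u5"
    and yI: "yI = y_zero_tilde \<kappa>1 \<kappa>2 k \<alpha> \<alpha>' u1 u2 a b + lin_comb k3 c u3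
      + sqrt (1 - \<kappa>1) *\<^sub>R lin_comb k4 d u4 + sqrt (1 - \<kappa>1 - \<kappa>2) *\<^sub>R lin_comb k5 e u5"
    and yI': "yI' = y_zero_tilde \<kappa>1 \<kappa>2 k \<alpha> \<alpha>' u1 u2 a' b' + lin_comb k3 c' u3
      + sqrt (1 - \<kappa>1) *\<^sub>R lin_comb k4 d' u4 + sqrt (1 - \<kappa>1 - \<kappa>2) *\<^sub>R lin_comb k5 e' u5"
    and yII: "yII = y_zero_tilde \<kappa>1 \<kappa>2 k \<alpha> \<alpha>' u1 u2 a b
      + sqrt (1 - \<kappa>1) *\<^sub>R lin_comb k4 d u4
      + sqrt (1 - \<kappa>1 - \<kappa>2 + \<kappa>1 * \<kappa>2 * P) *\<^sub>R lin_comb k5 e u5"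
    and yII': "yII' = y_zero_tilde \<kappa>1 \<kappa>2 k \<alpha> \<alpha>' u1 u2 a' b'
      + sqrt (1 - \<kappa>1) *\<^sub>R lin_comb k4 d' u4
      + sqrt (1 - \<kappa>1 - \<kappa>2 + \<kappa>1 * \<kappa>2 * P) *\<^sub>R lin_comb k5 e' u5"
  shows "(span E1 \<inter> span E2 \<noteq> {0} \<longrightarrow>
      0 \<le> (wedge_norm [yI, yI'])\<^sup>2
        - (1 - \<kappa>1 - \<kappa>2) *
            ((wedge_norm [y, y'])\<^sup>2
             - \<kappa>1 * (wedge_norm ([y, y'] @ fam u1 k @ fam u3 k3))\<^sup>2
             - \<kappa>2 * (wedge_norm ([y, y'] @ fam v k @ fam u3 k3 @ fam u4 k4))\<^sup>2))
    \<and> (span E1 \<inter> span E2 = {0} \<longrightarrow>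
      0 \<le> (wedge_norm [yII, yII'])\<^sup>2
        - (1 - \<kappa>1 - \<kappa>2 + \<kappa>1 * \<kappa>2 * P) *
            ((wedge_norm [y, y'])\<^sup>2
             - \<kappa>1 * (wedge_norm ([y, y'] @ fam u1 k))\<^sup>2
             - \<kappa>2 * (wedge_norm ([y, y'] @ fam v k @ fam u4 k4))\<^sup>2
             + \<kappa>1 * \<kappa>2 * P * (wedge_norm ([y, y'] @ fam u1 k @ fam u2 k @ fam u4 k4))\<^sup>2))"
proof -

  \<comment> \<open>Orthonormal bases of the spans, and the intersection of the spans\<close>
  note on = u_orthonormal
  have on1: "orthonormal_list (fam u1 k)" "orthonormal_list (fam u2 k)" "orthonormal_list (fam u3 k3)"
      "orthonormal_list (fam u4 k4)"
    and on2: "\<And>i j. i < k \<Longrightarrow> j < k \<Longrightarrow> inner (u1 i) (u2 j) = 0"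
      "\<And>i j. i < k \<Longrightarrow> j < k3 \<Longrightarrow> inner (u1 i) (u3 j) = 0"
      "\<And>i j. i < k \<Longrightarrow> j < k4 \<Longrightarrow> inner (u1 i) (u4 j) = 0"
      "\<And>i j. i < k \<Longrightarrow> j < k3 \<Longrightarrow> inner (u2 i) (u3 j) = 0"
      "\<And>i j. i < k \<Longrightarrow> j < k4 \<Longrightarrow> inner (u2 i) (u4 j) = 0"
      "\<And>i j. i < k3 \<Longrightarrow> j < k4 \<Longrightarrow> inner (u3 i) (u4 j) = 0"
    using on by (auto simp: orthonormal_list_append)
  have onv: "orthonormal_list (fam v k)"
    unfolding orthonormal_fam
  proof (intro allI impI)
    fix i j assume ij: "i < k" "j < k"
    have "inner (v i) (v j) = (if i = j then cos (\<alpha> i) * cos (\<alpha> i) + sin (\<alpha> i) * sin (\<alpha> i) else 0)"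
      using ij on1(1,2) on2(1)[of i j] on2(1)[of j i]
      by (auto simp: v inner_add_left inner_add_right orthonormal_fam inner_commute)
    then show "inner (v i) (v j) = (if i = j then 1 else 0)" by simp
  qed
  define bs1 where "bs1 = fam u1 k @ fam u3 k3"
  define bs2 where "bs2 = fam v k @ fam u3 k3 @ fam u4 k4"
  define bs3 where "bs3 = fam u1 k @ fam u2 k @ fam u4 k4"
  have onbs1: "orthonormal_list bs1"
    using on1 on2 by (auto simp: bs1_def orthonormal_list_append)
  have onbs2: "orthonormal_list bs2"
    using on1 on2 onv by (auto simp: bs2_def orthonormal_list_append v inner_add_left)
  have onbs3: "orthonormal_list bs3"
    using on1 on2 by (auto simp: bs3_def orthonormal_list_append)

  have span1: "span E1 = span (set bs1)" and span2: "span E2 = span (set bs2)"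
    using basis_E1 basis_E2 by (simp_all add: is_basis_of_def bs1_def bs2_def)
  have len: "length es1 = length bs1" "length es2 = length bs2"
    using E1 E2 es1 es2 dims distinct_card[of es1] distinct_card[of es2] by (simp_all add: bs1_def bs2_def)
  \<comment> \<open>Passing from \<open>es1\<close> and \<open>es2\<close> to orthonormal bases of
    their spans costs the factors \<open>\<kappa>1\<close> and \<open>\<kappa>2\<close>; what
    remains depends only on the relative position of the spans.\<close>
  have wedge12: "(wedge_norm (es1 @ es2))\<^sup>2 = \<kappa>1 * \<kappa>2 * wedge_inner (bs1 @ bs2) (bs1 @ bs2)"
    unfolding \<kappa>1(1) \<kappa>2(1) wedge_norm_power2
    by (rule wedge_inner_append_span)
      (use onbs1 onbs2 len span1 span2 es1 es2 in \<open>auto intro: span_base\<close>)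

  \<comment> \<open>Vectors in the span of \<open>E1\<close> are orthogonal to all
    \<open>u2 j\<close> and \<open>u4 j\<close>. So the expansion in \<open>bs2\<close> has no
    \<open>u4\<close> part, and pairing with \<open>u2 j\<close> isolates the coefficient of
    \<open>v j\<close> times a positive sine.\<close>
  have trivial_Int: "span E1 \<inter> span E2 = {0}" if "k3 = 0"
  proof (intro equalityI subsetI)
    fix x assume x: "x \<in> span E1 \<inter> span E2"
    have orth: "inner x w = 0" if w: "\<And>i. i < k \<Longrightarrow> inner (u1 i) w = 0" for w
    proof -
      have "x = (\<Sum>j<k. inner x (u1 j) *\<^sub>R u1 j)"
        using orthonormal_list_expansion[OF onbs1, of x] x \<open>k3 = 0\<close> by (simp add: span1 bs1_def)
      then have "inner x w = (\<Sum>j<k. inner x (u1 j) * inner (u1 j) w)"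
        by (metis (no_types, lifting) inner_scaleR_left inner_sum_left sum.cong)
      then show ?thesis using w by simp
    qed
    have x4: "inner x (u4 j) = 0" if "j < k4" for j using that on2(3) by (intro orth)
    have x2: "inner x (u2 j) = 0" if "j < k" for j using that on2(1) by (intro orth)
    have xv: "x = (\<Sum>j<k. inner x (v j) *\<^sub>R v j)"
      using orthonormal_list_expansion[OF onbs2, of x] x \<open>k3 = 0\<close> x4
      by (simp add: span2 bs2_def sum_lessThan_add nth_append)
    have "inner x (v j) = 0" if j: "j < k" for j
    proof -
      have "inner x (u2 j) = (\<Sum>i<k. inner x (v i) * inner (v i) (u2 j))"
        by (subst xv) (simp add: inner_sum_left)
      also have "\<dots> = (\<Sum>i<k. if i = j then inner x (v i) * sin (\<alpha> i) else 0)"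
        using on1(2) on2(1) j by (intro sum.cong) (auto simp: v inner_add_left orthonormal_fam)
      finally have "inner x (v j) * sin (\<alpha> j) = 0" using x2 j by simp
      moreover have "sin (\<alpha> j) > 0" using \<alpha>[OF j] by (intro sin_gt_zero) auto
      ultimately show ?thesis by simp
    qed
    then show "x \<in> {0}" using xv by simp
  qed (auto intro: span_zero)
  have nontrivial_Int: "span E1 \<inter> span E2 \<noteq> {0}" if "k3 > 0"
  proof -
    have "u3 0 \<in> span E1 \<inter> span E2"
      unfolding span1 span2 using that by (auto simp: bs1_def bs2_def intro!: span_base)
    moreover have "inner (u3 0) (u3 0) = 1" using on1(3) that by (simp add: orthonormal_fam)
    then have "u3 0 \<noteq> 0" by (metis inner_zero_left zero_neq_one)
    ultimately show ?thesis by blast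
  qed

  \<comment> \<open>Gram forms of the vectors and of their projections\<close>
  define g g' h h' where "g i = a i + b i * cos (\<alpha> i)" and "g' i = a' i + b' i * cos (\<alpha> i)"
    and "h i = b i * sin (\<alpha> i)" and "h' i = b' i * sin (\<alpha> i)" for i
  define I where "I = gram_form y y'"
  define FA where "FA = (\<Sum>i<k. sqform (g i) (g' i))"
  define FR where "FR = (\<Sum>i<k. sqform (g i) (g' i) + sqform (h i) (h' i))"
  define FB where "FB = (\<Sum>i<k. sqform (cos (\<alpha> i) * g i + sin (\<alpha> i) * h i) (cos (\<alpha> i) * g' i + sin (\<alpha> i) * h' i))"
  define F3 where "F3 = (\<Sum>i<k3. sqform (c i) (c' i))"
  define F4 where "F4 = (\<Sum>i<k4. sqform (d i) (d' i))"
  define F5 where "F5 = (\<Sum>i<k5. sqform (e i) (e' i))"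
  have yY: "y = lin_comb k g u1 + lin_comb k h u2 + lin_comb k3 c u3 + lin_comb k4 d u4 + lin_comb k5 e u5"
    and yY': "y' = lin_comb k g' u1 + lin_comb k h' u2 + lin_comb k3 c' u3 + lin_comb k4 d' u4 + lin_comb k5 e' u5"
    unfolding y y' y_zero_def g_def h_def g'_def h'_def by simp_all
  have yu: "inner y (u1 i) = g i" "inner y' (u1 i) = g' i" "inner y (u2 i) = h i" "inner y' (u2 i) = h' i"
    "inner y (v i) = cos (\<alpha> i) * g i + sin (\<alpha> i) * h i" "inner y' (v i) = cos (\<alpha> i) * g' i + sin (\<alpha> i) * h' i"
    if "i < k" for i
    using that v unfolding yY yY' by (simp_all add: inner_lin_comb5[OF on] inner_add_right)
  have yu3: "inner y (u3 i) = c i" "inner y' (u3 i) = c' i" if "i < k3" for i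
    using that unfolding yY yY' by (simp_all add: inner_lin_comb5[OF on])
  have yu4: "inner y (u4 i) = d i" "inner y' (u4 i) = d' i" if "i < k4" for i
    using that unfolding yY yY' by (simp_all add: inner_lin_comb5[OF on])
  have I: "I = FR + F3 + F4 + F5"
    unfolding I_def yY yY' gram_form_lin_comb5[OF on] FR_def F3_def F4_def F5_def ..
  have proj1: "(\<Sum>j<length bs1. sqform (inner y (bs1 ! j)) (inner y' (bs1 ! j))) = FA + F3"
    by (simp add: bs1_def sum_lessThan_add nth_append FA_def F3_def yu yu3)
  have proj2: "(\<Sum>j<length bs2. sqform (inner y (bs2 ! j)) (inner y' (bs2 ! j))) = FB + F3 + F4"
    by (simp add: bs2_def sum_lessThan_add nth_append FB_def F3_def F4_def yu yu3 yu4 add.assoc)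
  have proj3: "(\<Sum>j<length bs3. sqform (inner y (bs3 ! j)) (inner y' (bs3 ! j))) = FR + F4"
    by (simp add: bs3_def sum_lessThan_add nth_append FR_def F4_def yu yu4 sum.distrib add.assoc)
  have w0: "(wedge_norm [y, y'])\<^sup>2 = polar I I / 2"
    by (simp add: wedge_norm_power2 wedge_inner_pair I_def)
  have w1: "(wedge_norm ([y, y'] @ bs1))\<^sup>2 = polar (I - (FA + F3)) (I - (FA + F3)) / 2"
    unfolding wedge_norm_power2 wedge_inner_pair_append_orthonormal[OF onbs1] proj1 I_def ..
  have w2: "(wedge_norm ([y, y'] @ bs2))\<^sup>2 = polar (I - (FB + F3 + F4)) (I - (FB + F3 + F4)) / 2"
    unfolding wedge_norm_power2 wedge_inner_pair_append_orthonormal[OF onbs2] proj2 I_def ..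
  have w3: "(wedge_norm ([y, y'] @ bs3))\<^sup>2 = polar (I - (FR + F4)) (I - (FR + F4)) / 2"
    unfolding wedge_norm_power2 wedge_inner_pair_append_orthonormal[OF onbs3] proj3 I_def ..

  have sin2: "0 < (sin (\<alpha> i))\<^sup>2" "(sin (\<alpha> i))\<^sup>2 < 1" if "i < k" for i
  proof -
    have "0 < sin (\<alpha> i)" "0 < cos (\<alpha> i)"
      using \<alpha>[OF that] by (auto intro: sin_gt_zero cos_gt_zero)
    then have "0 < (sin (\<alpha> i))\<^sup>2" "0 < (cos (\<alpha> i))\<^sup>2" by simp_all
    then show "0 < (sin (\<alpha> i))\<^sup>2" "(sin (\<alpha> i))\<^sup>2 < 1"
      using sin_cos_squared_add[of "\<alpha> i"] by linarith+
  qed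
  have delta_pos: "0 < delta \<kappa> (\<alpha> i)" if "i < k" "0 < \<kappa>" "\<kappa> < 1" for i \<kappa>
  proof -
    have "\<kappa> * (sin (\<alpha> i))\<^sup>2 \<le> \<kappa>" using sin2[OF that(1)] that by (simp add: mult_left_le)
    then show ?thesis using that unfolding delta_def by linarith
  qed
  \<comment> \<open>Serves both cases: \<open>C\<close> is the square of the factor at the
    \<open>u5\<close> part, and in Case II the \<open>u3\<close> part is an empty sum.\<close>
  have tilde: "gram_form
      (y_zero_tilde \<kappa>1 \<kappa>2 k \<alpha> \<alpha>' u1 u2 a b + lin_comb k3 c3 u3
        + sqrt (1 - \<kappa>1) *\<^sub>R lin_comb k4 d u4 + sqrt C *\<^sub>R lin_comb k5 e u5)
      (y_zero_tilde \<kappa>1 \<kappa>2 k \<alpha> \<alpha>' u1 u2 a' b' + lin_comb k3 c3' u3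
        + sqrt (1 - \<kappa>1) *\<^sub>R lin_comb k4 d' u4 + sqrt C *\<^sub>R lin_comb k5 e' u5)
    = (1 - \<kappa>1 - \<kappa>2) *\<^sub>R FR + \<kappa>1 *\<^sub>R FA + \<kappa>2 *\<^sub>R FB
      + (\<Sum>i<k3. sqform (c3 i) (c3' i)) + (1 - \<kappa>1) *\<^sub>R F4 + C *\<^sub>R F5"
    if "0 \<le> C" for C c3 c3'
  proof -
    have scale: "sqform (sqrt r * s) (sqrt r * t) = r *\<^sub>R sqform s t" if "0 \<le> r" for r s t
      using that by (simp add: sqform_def mult_ac)
    have "(\<Sum>i<k. sqform (a i * sqrt (delta \<kappa>2 (\<alpha> i)) + b i * sqrt (delta \<kappa>1 (\<alpha> i)) * cos (\<alpha>' i))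
          (a' i * sqrt (delta \<kappa>2 (\<alpha> i)) + b' i * sqrt (delta \<kappa>1 (\<alpha> i)) * cos (\<alpha>' i))
        + sqform (b i * sqrt (delta \<kappa>1 (\<alpha> i)) * sin (\<alpha>' i)) (b' i * sqrt (delta \<kappa>1 (\<alpha> i)) * sin (\<alpha>' i)))
      = (1 - \<kappa>1 - \<kappa>2) *\<^sub>R FR + \<kappa>1 *\<^sub>R FA + \<kappa>2 *\<^sub>R FB"
      unfolding FR_def FA_def FB_def scaleR_sum_right sum.distrib[symmetric] g_def g'_def h_def h'_def
      by (intro sum.cong refl sqform_tilde) (use delta_pos \<alpha>' \<kappa>1 \<kappa>2 in auto)
    then show ?thesis
      unfolding y_zero_tilde_def lin_comb_scaleR gram_form_lin_comb5[OF on] F4_def F5_def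
      using that \<kappa>1 by (simp add: scale scaleR_sum_right)
  qed

  \<comment> \<open>The two cases\<close>
  show ?thesis
  proof (intro conjI impI)
    assume "span E1 \<inter> span E2 \<noteq> {0}"
    then have k3: "0 < k3" using trivial_Int by blast
    \<comment> \<open>A vector common to both bases makes the product vanish, so
      \<open>\<kappa>12\<close> becomes positivity of
      \<open>1 - \<kappa>1 - \<kappa>2\<close>.\<close>
    then have "u3 0 \<in> set bs1 \<inter> set bs2" by (auto simp: bs1_def bs2_def)
    then have "\<not> distinct (bs1 @ bs2)" by auto
    then have C: "0 < 1 - \<kappa>1 - \<kappa>2" using \<kappa>12(1) by (simp add: wedge12 wedge_inner_repeated)
    let ?A = "FA + F3" and ?B = "FB + F3 + F4"
    \<comment> \<open>On the right \<open>F3\<close> collects the coefficient 1, \<open>F4\<close>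
      collects \<open>1 - \<kappa>1\<close> and \<open>F5\<close> collects
      \<open>1 - \<kappa>1 - \<kappa>2\<close>: the squares of the factors in the modified
      vectors.\<close>
    have "gram_form yI yI' = (1 - \<kappa>1 - \<kappa>2) *\<^sub>R I + (\<kappa>1 *\<^sub>R ?A + \<kappa>2 *\<^sub>R ?B)"
      unfolding yI yI' tilde[OF less_imp_le[OF C]] I F3_def by (simp add: algebra_simps)
    then have "(wedge_norm [yI, yI'])\<^sup>2 = polar ((1 - \<kappa>1 - \<kappa>2) *\<^sub>R I + (\<kappa>1 *\<^sub>R ?A + \<kappa>2 *\<^sub>R ?B))
        ((1 - \<kappa>1 - \<kappa>2) *\<^sub>R I + (\<kappa>1 *\<^sub>R ?A + \<kappa>2 *\<^sub>R ?B)) / 2"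
      by (simp add: wedge_norm_power2 wedge_inner_pair)
    then have "(wedge_norm [yI, yI'])\<^sup>2 - (1 - \<kappa>1 - \<kappa>2) *
          ((wedge_norm [y, y'])\<^sup>2 - \<kappa>1 * (wedge_norm ([y, y'] @ bs1))\<^sup>2 - \<kappa>2 * (wedge_norm ([y, y'] @ bs2))\<^sup>2)
      = (polar (\<kappa>1 *\<^sub>R ?A + \<kappa>2 *\<^sub>R ?B) (\<kappa>1 *\<^sub>R ?A + \<kappa>2 *\<^sub>R ?B)
          + (1 - \<kappa>1 - \<kappa>2) * (\<kappa>1 * polar ?A ?A + \<kappa>2 * polar ?B ?B)) / 2"
      using polar_expansion[of \<kappa>1 \<kappa>2 0 I ?A ?B 0] unfolding w0 w1 w2 by (simp add: field_simps)
    moreover have "0 \<le> polar ?A ?A" "0 \<le> polar ?A ?B" "0 \<le> polar ?B ?B"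
      unfolding proj1[symmetric] proj2[symmetric] by (rule polar_sum_sqform_nonneg)+
    then have "0 \<le> polar (\<kappa>1 *\<^sub>R ?A + \<kappa>2 *\<^sub>R ?B) (\<kappa>1 *\<^sub>R ?A + \<kappa>2 *\<^sub>R ?B)
          + (1 - \<kappa>1 - \<kappa>2) * (\<kappa>1 * polar ?A ?A + \<kappa>2 * polar ?B ?B)"
      unfolding bilinear_ladd[OF bilinear_polar, of "\<kappa>1 *\<^sub>R ?A"] bilinear_radd[OF bilinear_polar, of _ "\<kappa>1 *\<^sub>R ?A"]
        bilinear_lmul[OF bilinear_polar] bilinear_rmul[OF bilinear_polar] polar_commute[of ?B ?A]
      using C \<kappa>1(2) \<kappa>2(2) by simp
    ultimately show "0 \<le> (wedge_norm [yI, yI'])\<^sup>2 - (1 - \<kappa>1 - \<kappa>2) *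
            ((wedge_norm [y, y'])\<^sup>2
             - \<kappa>1 * (wedge_norm ([y, y'] @ fam u1 k @ fam u3 k3))\<^sup>2
             - \<kappa>2 * (wedge_norm ([y, y'] @ fam v k @ fam u3 k3 @ fam u4 k4))\<^sup>2)"
      unfolding bs1_def bs2_def by simp
  next
    assume "span E1 \<inter> span E2 = {0}"
    then have k3: "k3 = 0" using nontrivial_Int by blast
    then have F3: "F3 = 0" by (simp add: F3_def)
    have bs: "bs1 = fam u1 k" "bs2 = fam v k @ fam u4 k4" by (simp_all add: bs1_def bs2_def k3)
    define \<tau> where "\<tau> = \<kappa>1 * \<kappa>2 * P"
    have "wedge_inner (bs1 @ bs2) (bs1 @ bs2) = P"
      using wedge_inner_rotated[OF onbs3[unfolded bs3_def] v] by (simp add: bs P)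
    then have C: "0 < 1 - \<kappa>1 - \<kappa>2 + \<tau>" using \<kappa>12(1) by (simp add: wedge12 \<tau>_def)
    let ?C = "1 - \<kappa>1 - \<kappa>2 + \<tau>" and ?B = "FB + F4" and ?R = "FR + F4"
    let ?X = "\<kappa>1 *\<^sub>R FA + \<kappa>2 *\<^sub>R ?B - \<tau> *\<^sub>R ?R"
    have "gram_form yII yII' = ?C *\<^sub>R I + ?X"
    proof -
      have "lin_comb k3 f u3 = 0" for f by (simp add: lin_comb_def k3)
      then have "gram_form yII yII' = (1 - \<kappa>1 - \<kappa>2) *\<^sub>R FR + \<kappa>1 *\<^sub>R FA + \<kappa>2 *\<^sub>R FB + (1 - \<kappa>1) *\<^sub>R F4 + ?C *\<^sub>R F5"
        using tilde[OF less_imp_le[OF C], of c c'] unfolding yII yII' \<tau>_def[symmetric] by (simp add: k3)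
      \<comment> \<open>The term \<open>\<tau> *\<^sub>R ?R\<close> adjusts the coefficients:
        \<open>FR\<close> gets \<open>?C - \<tau>\<close> and \<open>F4\<close> gets
        \<open>?C + \<kappa>2 - \<tau> = 1 - \<kappa>1\<close>.\<close>
      then show ?thesis unfolding I F3 by (simp add: algebra_simps)
    qed
    then have wII: "(wedge_norm [yII, yII'])\<^sup>2 = polar (?C *\<^sub>R I + ?X) (?C *\<^sub>R I + ?X) / 2"
      by (simp add: wedge_norm_power2 wedge_inner_pair)
    have half: "D / 2 - C * (i / 2 - p * (j / 2) - q * (l / 2) + t * (m / 2))
        = (D - C * (i - p * j - q * l + t * m)) / 2" for D C i p j q l t m :: real
      by (simp add: field_simps)
    have "(wedge_norm [yII, yII'])\<^sup>2 - ?C *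
          ((wedge_norm [y, y'])\<^sup>2 - \<kappa>1 * (wedge_norm ([y, y'] @ bs1))\<^sup>2 - \<kappa>2 * (wedge_norm ([y, y'] @ bs2))\<^sup>2
            + \<tau> * (wedge_norm ([y, y'] @ bs3))\<^sup>2)
      = (polar ?X ?X + ?C * (\<kappa>1 * polar FA FA + \<kappa>2 * polar ?B ?B - \<tau> * polar ?R ?R)) / 2"
      unfolding wII w0 w1 w2 w3 F3 add_0_right half polar_expansion ..
    also have "\<dots> = Phi \<kappa>1 \<kappa>2 \<tau> (FA, ?B, ?R) (FA, ?B, ?R) / 2"
      by (simp add: Phi_def)
    also have "0 \<le> \<dots>"
    proof -
      have "(FA, ?B, ?R) = (\<Sum>i<k. plane_block (cos (\<alpha> i)) (sin (\<alpha> i)) (g i) (g' i) (h i) (h' i))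
          + (\<Sum>l<k4. line_block (d l) (d' l))"
        by (simp add: prod_eq_iff fst_sum snd_sum plane_block_def line_block_def FA_def FB_def FR_def F4_def)
      moreover have "0 \<le> Phi \<kappa>1 \<kappa>2 \<tau> V V"
        if "V = (\<Sum>i<k. plane_block (cos (\<alpha> i)) (sin (\<alpha> i)) (g i) (g' i) (h i) (h' i))
          + (\<Sum>l<k4. line_block (d l) (d' l))" for V
        unfolding that
        by (rule Phi_blocks_nonneg) (use \<kappa>1(2,3) \<kappa>2(2,3) sin2 C in \<open>auto simp: \<tau>_def P\<close>)
      ultimately show ?thesis by simp
    qed
    finally have "0 \<le> (wedge_norm [yII, yII'])\<^sup>2 - ?C *
          ((wedge_norm [y, y'])\<^sup>2 - \<kappa>1 * (wedge_norm ([y, y'] @ bs1))\<^sup>2 - \<kappa>2 * (wedge_norm ([y, y'] @ bs2))\<^sup>2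
            + \<tau> * (wedge_norm ([y, y'] @ bs3))\<^sup>2)" .
    then show "0 \<le> (wedge_norm [yII, yII'])\<^sup>2
        - (1 - \<kappa>1 - \<kappa>2 + \<kappa>1 * \<kappa>2 * P) *
            ((wedge_norm [y, y'])\<^sup>2
             - \<kappa>1 * (wedge_norm ([y, y'] @ fam u1 k))\<^sup>2
             - \<kappa>2 * (wedge_norm ([y, y'] @ fam v k @ fam u4 k4))\<^sup>2
             + \<kappa>1 * \<kappa>2 * P * (wedge_norm ([y, y'] @ fam u1 k @ fam u2 k @ fam u4 k4))\<^sup>2)"
      by (simp add: bs bs3_def \<tau>_def)
  qed
qed

end
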